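(* Let $n,w\ge1$ and let $f\colon\mathbb{R}^n\to\mathbb{R}$ be a non-constant function $$f(x)=c_0+\sum_{k=1}^w d_k\,\sigma(a_k^{\top}x+b_k),$$ where $\sigma(u)=(1+e^{-u})^{-1}$ is the logistic sigmoid, $c_0,b_k,d_k\in\mathbb{R}$, and $a_1,\dots,a_w\in\mathbb{Q}^n$ have common denominator $q\in\mathbb{N}_{>0}$ (i.e. $q\,a_k\in\mathbb{Z}^n$ for all $k$); set $L=q\max_{k,i}|a_{ki}|$ and $V=\{x:f(x)=0\}$. Assume that $\nabla f$ is non-vanishing on $V$ and that $V$ is contained in the closed ball $B(p,\rho)$, $p\in\mathbb{R}^n$, $\rho>0$, and let $X$ be uniformly distributed on $B(p,\rho)$. Then, for $\varepsilon>0$, $$\mathbb{P}\{d(X,V)\le\varepsilon\}\le 2n(2Lw+1)^n\,\frac{\varepsilon}{\rho}+O\!\left(w^{2n}\left(\frac{\varepsilon}{\rho}\right)^2\right),$$ where the implied constant depends only on $n$ and $L$. In particular, the right-hand side is of order $O(w^n\,\varepsilon/\rho)$ in the regime $\varepsilon/\rho=O(w^{-n})$: for every $A>0$ there is a constant $C'$ depending only on $n,L,A$ such that $\mathbb{P}\{d(X,V)\le\varepsilon\}\le C'\,w^n\,\varepsilon/\rho$ whenever $\varepsilon/\rho\le A\,w^{-n}$.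
   Context: $d(x,V)=\inf_{y\in V}\|x-y\|$ is Euclidean distance. *)

theory Defs
  imports "HOL-Probability.Probability"
begin

definition logistic :: "real \<Rightarrow> real" where
  "logistic u = inverse (1 + exp (- u))"

(* The common denominator q need not be the least one; L is tied to the chosen q. *)
definition rational_sigmoid_network :: "nat \<Rightarrow> real \<Rightarrow> (real ^ 'n \<Rightarrow> real) \<Rightarrow> bool" where
  "rational_sigmoid_network w L f \<longleftrightarrow>
    (\<exists>(c0 :: real) (d :: nat \<Rightarrow> real) (a :: nat \<Rightarrow> real ^ 'n) (b :: nat \<Rightarrow> real) (q :: nat).
       (\<forall>x. f x = c0 + (\<Sum>k = 1..w. d k * logistic (a k \<bullet> x + b k))) \<and>
       (\<forall>k \<in> {1..w}. \<forall>i. a k $ i \<in> \<rat>) \<and>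
       q > 0 \<and> (\<forall>k \<in> {1..w}. \<forall>i. real q * a k $ i \<in> \<int>) \<and>
       L = real q * Max {\<bar>a k $ i\<bar> | k i. k \<in> {1..w}})"

definition gradient :: "('a :: real_inner \<Rightarrow> real) \<Rightarrow> 'a \<Rightarrow> 'a" where
  "gradient f x = (THE g. GDERIV f x :> g)"

lemma gradient_eqI:
  assumes "GDERIV f x :> g"
  shows "gradient f x = g"
proof -
  have "h = g" if "GDERIV f x :> h" for h
  proof -
    have "(\<lambda>y. y \<bullet> h) = (\<lambda>y. y \<bullet> g)"
      using that assms unfolding gderiv_def by (rule has_derivative_unique)
    then have "(h - g) \<bullet> (h - g) = 0"
      by (metis inner_diff_right right_minus_eq)
    then show ?thesis by simp
  qed
  with assms show ?thesis unfolding gradient_def by blast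
qed

definition zero_set :: "('a \<Rightarrow> real) \<Rightarrow> 'a set" where
  "zero_set f = {x. f x = 0}"

(* Extended-real valued, so that the distance to the empty set is the infimum of the
   empty set, i.e. infinity; the library's infdist would give 0 there. *)
definition set_distance :: "'a :: metric_space \<Rightarrow> 'a set \<Rightarrow> ereal" where
  "set_distance x V = (INF y \<in> V. ereal (dist x y))"

end

theory Submission
  imports Defs "HOL-Computational_Algebra.Polynomial"
begin

text \<open>
  If \<open>d(x, V) \<le> \<epsilon>\<close>, then the cube \<open>x + [-\<epsilon>, \<epsilon>]\<^sup>n\<close> meets \<open>V\<close>, so either one of its edges meets \<open>V\<close>,
  or some face of dimension at least 2 meets \<open>V\<close> while its relative boundary does not.
  In the variables \<open>y\<^sub>i = exp (x\<^sub>i / q)\<close> the network is a quotient of polynomials of degree at most \<open>L w\<close>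
  in each variable, with positive denominator. An axis-parallel line thus meets the bounded set \<open>V\<close> in at
  most \<open>L w\<close> points, and the edges account for the first-order term. A \<open>j\<close>-face of the second kind contains
  an interior minimum of the squared numerator, and so does every small perturbation of it; adding
  \<open>\<eta> \<Sum>\<^sub>i y\<^sub>i\<^bsup>d+1\<^esup>\<close> makes the critical equations a system with at most \<open>(d + 1)\<^sup>j\<close> solutions. Hence in a
  \<open>j\<close>-plane only \<open>O((L w)\<^sup>j)\<close> pairwise disjoint faces are of this kind. Averaging over translates of the
  lattice \<open>4 \<epsilon> \<int>\<^sup>j\<close> turns these counts into volume bounds, and the faces with \<open>j \<ge> 2\<close> are of second order.
\<close>

section \<open>Exponential polynomials\<close>

text \<open>Gaussian elimination for \<open>card B\<close> homogeneous equations in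
  \<open>card S\<close> unknowns. Its use is to produce a linear relation between evaluations at the
  points of a solution set that would be too large.\<close>

lemma nontrivial_kernel:
  fixes F :: "'b \<Rightarrow> 'a \<Rightarrow> real"
  assumes "finite B" "finite S" "card B < card S"
  shows "\<exists>x. (\<exists>t\<in>S. x t \<noteq> 0) \<and> (\<forall>b\<in>B. (\<Sum>t\<in>S. x t * F b t) = 0)"
  using assms
proof (induction B arbitrary: S F rule: finite_induct)
  case empty
  then have "S \<noteq> {}" by auto
  then show ?case by (intro exI[of _ "\<lambda>_. 1"]) auto
next
  case (insert b B)
  show ?case
  proof (cases "\<forall>t\<in>S. F b t = 0")
    case True
    obtain x where "\<exists>t\<in>S. x t \<noteq> 0" "\<forall>b\<in>B. (\<Sum>t\<in>S. x t * F b t) = 0"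
      using insert.IH[of S F] insert.prems insert.hyps by auto
    with True show ?thesis by (intro exI[of _ x]) auto
  next
    case False
    then obtain t0 where t0: "t0 \<in> S" "F b t0 \<noteq> 0" by blast
    \<comment> \<open>The unknown at the pivot \<open>t0\<close> is eliminated by means of equation
      \<open>b\<close>; the definition of \<open>y\<close> below recovers its value from that
      equation.\<close>
    define F' where "F' = (\<lambda>c t. F c t - F b t / F b t0 * F c t0)"
    have "card B < card (S - {t0})"
      using insert.prems insert.hyps t0 by simp
    then obtain x where x: "\<exists>t\<in>S - {t0}. x t \<noteq> 0"
        "\<forall>c\<in>B. (\<Sum>t\<in>S - {t0}. x t * F' c t) = 0"
      using insert.IH[of "S - {t0}" F'] insert.prems by auto
    define y where "y = x(t0 := - (\<Sum>t\<in>S - {t0}. x t * F b t) / F b t0)"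
    have split: "(\<Sum>t\<in>S. y t * F c t) =
        (\<Sum>t\<in>S - {t0}. x t * F c t) - (\<Sum>t\<in>S - {t0}. x t * F b t) / F b t0 * F c t0" for c
    proof -
      have "(\<Sum>t\<in>S. y t * F c t) = y t0 * F c t0 + (\<Sum>t\<in>S - {t0}. y t * F c t)"
        by (rule sum.remove[OF insert.prems(1) t0(1)])
      also have "(\<Sum>t\<in>S - {t0}. y t * F c t) = (\<Sum>t\<in>S - {t0}. x t * F c t)"
        by (rule sum.cong) (auto simp: y_def)
      finally show ?thesis by (simp add: y_def)
    qed
    have "(\<Sum>t\<in>S. y t * F c t) = 0" if "c \<in> insert b B" for c
    proof (cases "c = b")
      case True
      then show ?thesis using t0 by (simp add: split)
    next
      case False
      have "(\<Sum>t\<in>S. y t * F c t) = (\<Sum>t\<in>S - {t0}. x t * F' c t)"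
        by (simp add: split F'_def right_diff_distrib sum_subtractf sum_distrib_left
            sum_distrib_right sum_divide_distrib mult_ac)
      with x(2) False that show ?thesis by auto
    qed
    moreover have "\<exists>t\<in>S. y t \<noteq> 0" using x(1) by (auto simp: y_def)
    ultimately show ?thesis by blast
  qed
qed

text \<open>The monomial with exponent vector \<open>\<alpha>\<close> in the variables
  \<open>y\<^sub>i = exp (x\<^sub>i / q)\<close>, written as a single exponential so that a product
  simply adds exponents.\<close>

definition expmon :: "real \<Rightarrow> ('n::finite \<Rightarrow> nat) \<Rightarrow> real ^ 'n \<Rightarrow> real" where
  "expmon q \<alpha> x = exp ((\<Sum>i\<in>UNIV. real (\<alpha> i) * x $ i) / q)"

lemma expmon_add: "expmon q (\<lambda>i. \<alpha> i + \<beta> i) x = expmon q \<alpha> x * expmon q \<beta> x"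
  by (simp add: expmon_def exp_add[symmetric] add_divide_distrib[symmetric] sum.distrib[symmetric]
      algebra_simps)

lemma expmon_0: "expmon q (\<lambda>_. 0) x = 1"
  by (simp add: expmon_def)

lemma expmon_single: "expmon q (\<lambda>l. if l = i then m else 0) x = exp (real m * x $ i / q)"
proof -
  have "(\<Sum>l\<in>UNIV. real (if l = i then m else 0) * x $ l)
      = (\<Sum>l\<in>UNIV. if l = i then real m * x $ i else 0)"
    by (rule sum.cong) auto
  then show ?thesis by (simp add: expmon_def)
qed

text \<open>Polynomials in the \<open>y\<^sub>i\<close> with \<open>i \<in> J\<close>, of total
  degree at most \<open>d\<close>, seen as functions of \<open>x\<close>. Adding one monomial at a
  time lets every closure property go by induction, without keeping track of coefficients.\<close>

inductive_set expoly :: "real \<Rightarrow> 'n::finite set \<Rightarrow> nat \<Rightarrow> (real ^ 'n \<Rightarrow> real) set"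
  for q :: real and J :: "'n set" and d :: nat where
  zero: "(\<lambda>x. 0) \<in> expoly q J d"
| add_mon: "\<lbrakk>h \<in> expoly q J d; \<And>i. i \<notin> J \<Longrightarrow> \<alpha> i = 0; (\<Sum>i\<in>UNIV. \<alpha> i) \<le> d\<rbrakk>
    \<Longrightarrow> (\<lambda>x. c * expmon q \<alpha> x + h x) \<in> expoly q J d"

lemma expoly_mon:
  assumes "\<And>i. i \<notin> J \<Longrightarrow> \<alpha> i = 0" "(\<Sum>i\<in>UNIV. \<alpha> i) \<le> d"
  shows "(\<lambda>x. c * expmon q \<alpha> x) \<in> expoly q J d"
  using expoly.add_mon[OF expoly.zero assms, where c = c] by simp

lemma expoly_const: "(\<lambda>x. c) \<in> expoly q J d"
  using expoly_mon[of J "\<lambda>_. 0" d c q] by (simp add: expmon_0)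

lemma expoly_exp:
  assumes "i \<in> J" "m \<le> d"
  shows "(\<lambda>x. exp (real m * x $ i / q)) \<in> expoly q J d"
proof -
  have "(\<lambda>x. 1 * expmon q (\<lambda>l. if l = i then m else 0) x) \<in> expoly q J d"
    by (rule expoly_mon) (use assms in auto)
  then show ?thesis by (simp add: expmon_single)
qed

lemma expoly_add:
  assumes "h \<in> expoly q J d" "k \<in> expoly q J d"
  shows "(\<lambda>x. h x + k x) \<in> expoly q J d"
  using assms
proof (induction h rule: expoly.induct)
  case (add_mon h \<alpha> c)
  then show ?case using expoly.add_mon[of "\<lambda>x. h x + k x" q J d \<alpha> c] by (simp add: add_ac)
qed simp

lemma expoly_mult_mon:
  assumes "h \<in> expoly q J d" "\<And>i. i \<notin> J \<Longrightarrow> \<beta> i = 0" "(\<Sum>i\<in>UNIV. \<beta> i) \<le> e"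
  shows "(\<lambda>x. c * expmon q \<beta> x * h x) \<in> expoly q J (d + e)"
  using assms(1)
proof (induction h rule: expoly.induct)
  case zero
  then show ?case by (simp add: expoly.zero)
next
  case (add_mon h \<alpha> c')
  have "(\<lambda>x. (c * c') * expmon q (\<lambda>i. \<alpha> i + \<beta> i) x + c * expmon q \<beta> x * h x) \<in> expoly q J (d + e)"
    using add_mon assms by (intro expoly.add_mon) (auto simp: sum.distrib intro: add_mono)
  then show ?case by (simp add: expmon_add algebra_simps)
qed

lemma expoly_mult:
  assumes "h \<in> expoly q J d" "k \<in> expoly q J e"
  shows "(\<lambda>x. h x * k x) \<in> expoly q J (d + e)"
  using assms(2)
proof (induction k rule: expoly.induct)
  case zero
  then show ?case by (simp add: expoly.zero)
next
  case (add_mon k \<alpha> c)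
  then show ?case
    using expoly_add[OF expoly_mult_mon[OF assms(1) add_mon(2,3), of c] add_mon(4)]
    by (simp add: algebra_simps)
qed

lemma expoly_cmult: "h \<in> expoly q J d \<Longrightarrow> (\<lambda>x. c * h x) \<in> expoly q J d"
  using expoly_mult[OF expoly_const[of c q J 0], of h d] by simp

lemma expoly_prod:
  assumes "finite A" "\<And>a. a \<in> A \<Longrightarrow> h a \<in> expoly q J d"
  shows "(\<lambda>x. \<Prod>a\<in>A. h a x) \<in> expoly q J (card A * d)"
  using assms
proof (induction A rule: finite_induct)
  case empty
  then show ?case by (simp add: expoly_const)
next
  case (insert a A)
  then show ?case using expoly_mult[of "h a" q J d] by simp
qed

lemma has_field_derivative_expmon:
  "((\<lambda>t. expmon q \<alpha> (x + t *\<^sub>R axis i 1)) has_real_derivative (real (\<alpha> i) / q * expmon q \<alpha> x)) (at 0)"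
proof -
  have "(\<Sum>l\<in>UNIV. real (\<alpha> l) * (x + t *\<^sub>R axis i 1) $ l)
      = (\<Sum>l\<in>UNIV. real (\<alpha> l) * x $ l) + real (\<alpha> i) * t" for t
  proof -
    have "(\<Sum>l\<in>UNIV. real (\<alpha> l) * (t *\<^sub>R axis i 1) $ l) = (\<Sum>l\<in>UNIV. if l = i then real (\<alpha> i) * t else 0)"
      by (rule sum.cong) (auto simp: axis_def)
    then show ?thesis by (simp add: algebra_simps sum.distrib)
  qed
  then show ?thesis unfolding expmon_def
    by (cases "q = 0") (auto intro!: derivative_eq_intros)
qed

text \<open>In the variable \<open>x\<^sub>i\<close> each monomial is an eigenfunction of the
  partial derivative, with eigenvalue \<open>\<alpha> i / q\<close>. Hence the degree bound
  survives, which the critical equations rely on.\<close>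

lemma expoly_derivative:
  assumes "h \<in> expoly q J d"
  shows "\<exists>h'\<in>expoly q J d. \<forall>x. ((\<lambda>t. h (x + t *\<^sub>R axis i 1)) has_real_derivative h' x) (at 0)"
  using assms
proof (induction h rule: expoly.induct)
  case zero
  then show ?case by (intro bexI[of _ "\<lambda>x. 0"]) (auto intro: expoly.zero)
next
  case (add_mon h \<alpha> c)
  then obtain h' where h': "h' \<in> expoly q J d"
    "\<And>x. ((\<lambda>t. h (x + t *\<^sub>R axis i 1)) has_real_derivative h' x) (at 0)" by blast
  have "(\<lambda>x. (c * (real (\<alpha> i) / q)) * expmon q \<alpha> x + h' x) \<in> expoly q J d"
    by (rule expoly.add_mon) (use add_mon h' in auto)
  moreover have "((\<lambda>t. c * expmon q \<alpha> (x + t *\<^sub>R axis i 1) + h (x + t *\<^sub>R axis i 1))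
      has_real_derivative (c * (real (\<alpha> i) / q)) * expmon q \<alpha> x + h' x) (at 0)" for x
    using DERIV_add[OF DERIV_cmult[OF has_field_derivative_expmon] h'(2)] by (simp add: mult_ac)
  ultimately show ?case by (intro bexI) auto
qed

lemma expoly_continuous:
  assumes "h \<in> expoly q J d"
  shows "continuous_on A h"
  using assms
  by (induction rule: expoly.induct)
    (auto simp: expmon_def divide_inverse intro!: continuous_intros)

lemma expoly_singleton_poly:
  assumes "h \<in> expoly q {i} d"
  shows "\<exists>P :: real poly. degree P \<le> d \<and> (\<forall>x. h x = poly P (exp (x $ i / q)))"
  using assms
proof (induction rule: expoly.induct)
  case zero
  then show ?case by (intro exI[of _ 0]) auto
next
  case (add_mon h \<alpha> c)
  then obtain P where P: "degree P \<le> d" "\<And>x. h x = poly P (exp (x $ i / q))" by blast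
  have *: "\<alpha> = (\<lambda>l. if l = i then \<alpha> i else 0)" using add_mon(2) by auto
  have "expmon q \<alpha> x = exp (x $ i / q) ^ \<alpha> i" for x
    by (subst *) (simp add: expmon_single exp_of_nat_mult[symmetric])
  moreover have "\<alpha> i \<le> d"
    using add_mon(3) member_le_sum[of i UNIV \<alpha>] by auto
  ultimately show ?case using P
    by (intro exI[of _ "monom c (\<alpha> i) + P"])
      (auto simp: poly_monom intro: degree_add_le order_trans[OF degree_monom_le])
qed

text \<open>Each \<open>t\<close> other than \<open>s\<close> is removed by one factor
  \<open>y\<^sub>i - exp (t\<^sub>i / q)\<close> that does not vanish at \<open>s\<close>. The
  degree of the product may be anything.\<close>

lemma expoly_separate:
  assumes "finite S" "s \<in> S" "q > 0"
    and sep: "\<And>t. t \<in> S \<Longrightarrow> t \<noteq> s \<Longrightarrow> \<exists>i\<in>J. s $ i \<noteq> t $ i"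
  shows "\<exists>d. \<exists>h\<in>expoly q J d. h s \<noteq> 0 \<and> (\<forall>t\<in>S - {s}. h t = 0)"
proof -
  obtain i where i: "\<And>t. t \<in> S - {s} \<Longrightarrow> i t \<in> J \<and> s $ i t \<noteq> t $ i t"
    using sep by (metis DiffE singletonI)
  define h where "h = (\<lambda>t x. exp (real 1 * x $ i t / q) + - exp (t $ i t / q))"
  have "h t \<in> expoly q J 1" if "t \<in> S - {s}" for t
    unfolding h_def by (intro expoly_add expoly_exp expoly_const) (use i that in auto)
  then have "(\<lambda>x. \<Prod>t\<in>S - {s}. h t x) \<in> expoly q J (card (S - {s}) * 1)"
    using assms by (intro expoly_prod) auto
  moreover have "(\<Prod>t\<in>S - {s}. h t s) \<noteq> 0"
    using assms i by (auto simp: h_def)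
  moreover have "(\<Prod>t\<in>S - {s}. h t x) = 0" if "x \<in> S - {s}" for x
    using assms that by (auto simp: h_def)
  ultimately show ?thesis
    by (intro exI[of _ "card (S - {s}) * 1"] bexI[of _ "\<lambda>x. \<Prod>t\<in>S - {s}. h t x"]) blast+
qed

text \<open>Modulo the equations \<open>y\<^sub>i\<^bsup>d+1\<^esup> = R\<^sub>i(y)\<close> with \<open>y\<^sub>i = exp (x\<^sub>i / q)\<close> and \<open>deg R\<^sub>i \<le> d\<close>,
  every polynomial reduces to the monomials with all exponents at most \<open>d\<close>. As polynomials separate
  the solutions, there are no more solutions than such monomials.\<close>

lemma card_expoly_system_le:
  fixes S :: "(real ^ 'n::finite) set"
  assumes "q > 0" "finite S"
    and R: "\<And>i. i \<in> J \<Longrightarrow> R i \<in> expoly q J d"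
    and eq: "\<And>s i. s \<in> S \<Longrightarrow> i \<in> J \<Longrightarrow> exp (real (Suc d) * s $ i / q) = R i s"
    and sep: "\<And>s t. s \<in> S \<Longrightarrow> t \<in> S \<Longrightarrow> t \<noteq> s \<Longrightarrow> \<exists>i\<in>J. s $ i \<noteq> t $ i"
  shows "card S \<le> Suc d ^ card J"
proof (rule ccontr)
  \<comment> \<open>\<open>B\<close> indexes the monomials with all exponents at most
    \<open>d\<close>; the default value 0 outside \<open>J\<close> makes their number exactly
    \<open>Suc d ^ card J\<close>.\<close>
  define B where "B = PiE_dflt J 0 (\<lambda>_. {..d})"
  have "card B = Suc d ^ card J"
    by (simp add: B_def card_PiE_dflt)
  moreover have "finite B" unfolding B_def by (rule finite_PiE_dflt) auto
  moreover assume "\<not> card S \<le> Suc d ^ card J"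
  ultimately obtain x where x: "\<exists>t\<in>S. x t \<noteq> 0"
    "\<And>\<alpha>. \<alpha> \<in> B \<Longrightarrow> (\<Sum>t\<in>S. x t * expmon q \<alpha> t) = 0"
    using nontrivial_kernel[of B S "expmon q"] assms(2) by auto
  have poly0: "(\<Sum>t\<in>S. x t * h t) = 0"
    if "h \<in> expoly q J e" and mon: "\<And>\<alpha>. (\<And>i. i \<notin> J \<Longrightarrow> \<alpha> i = 0) \<Longrightarrow> (\<Sum>i\<in>UNIV. \<alpha> i) \<le> e
      \<Longrightarrow> (\<Sum>t\<in>S. x t * expmon q \<alpha> t) = 0" for h e
    using that(1)
  proof (induction rule: expoly.induct)
    case (add_mon h \<alpha> c)
    have "(\<Sum>t\<in>S. x t * (c * expmon q \<alpha> t + h t)) =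
      c * (\<Sum>t\<in>S. x t * expmon q \<alpha> t) + (\<Sum>t\<in>S. x t * h t)"
      by (simp add: algebra_simps sum.distrib sum_distrib_left)
    with add_mon mon show ?case by simp
  qed simp
  have mon0: "(\<Sum>t\<in>S. x t * expmon q \<alpha> t) = 0" if "\<And>i. i \<notin> J \<Longrightarrow> \<alpha> i = 0" for \<alpha>
    using that
  proof (induction "\<Sum>i\<in>UNIV. \<alpha> i" arbitrary: \<alpha> rule: less_induct)
    case less
    show ?case
    proof (cases "\<alpha> \<in> B")
      case True
      then show ?thesis by (rule x(2))
    next
      case False
      then obtain i where i: "i \<in> J" "Suc d \<le> \<alpha> i"
        using less.prems by (auto simp: B_def PiE_dflt_def not_le)
      define \<beta> where "\<beta> = \<alpha>(i := \<alpha> i - Suc d)"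
      have \<alpha>: "\<alpha> = (\<lambda>l. \<beta> l + (if l = i then Suc d else 0))"
        using i by (auto simp: \<beta>_def)
      have sum\<alpha>: "(\<Sum>l\<in>UNIV. \<alpha> l) = (\<Sum>l\<in>UNIV. \<beta> l) + Suc d"
        by (subst \<alpha>) (simp add: sum.distrib del: if_distrib)
      have "(\<Sum>t\<in>S. x t * expmon q \<alpha> t) = (\<Sum>t\<in>S. x t * (1 * expmon q \<beta> t * R i t))"
        using eq i by (subst \<alpha>, intro sum.cong) (simp_all add: expmon_add expmon_single)
      also have "\<dots> = 0"
      proof (rule poly0)
        show "(\<lambda>t. 1 * expmon q \<beta> t * R i t) \<in> expoly q J (d + (\<Sum>l\<in>UNIV. \<beta> l))"
          using less.prems i by (intro expoly_mult_mon R) (auto simp: \<beta>_def)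
      next
        fix \<gamma> :: "'n \<Rightarrow> nat"
        assume \<gamma>: "\<And>i. i \<notin> J \<Longrightarrow> \<gamma> i = 0" "(\<Sum>i\<in>UNIV. \<gamma> i) \<le> d + (\<Sum>l\<in>UNIV. \<beta> l)"
        show "(\<Sum>t\<in>S. x t * expmon q \<gamma> t) = 0"
          using \<gamma> sum\<alpha> by (intro less.hyps) auto
      qed
      finally show ?thesis .
    qed
  qed
  obtain s where s: "s \<in> S" "x s \<noteq> 0" using x(1) by blast
  \<comment> \<open>A polynomial that vanishes on \<open>S\<close> except at \<open>s\<close>
    isolates the nonzero coefficient \<open>x s\<close>, contradicting that the relation annihilates
    all polynomials.\<close>
  obtain e h where h: "h \<in> expoly q J e" "h s \<noteq> 0" "\<forall>t\<in>S - {s}. h t = 0"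
    using expoly_separate[of S s q J] assms s by blast
  have "(\<Sum>t\<in>S. x t * h t) = x s * h s"
    using h(3) s assms(2) by (subst sum.remove[OF _ s(1)]) auto
  moreover have "(\<Sum>t\<in>S. x t * h t) = 0"
    by (rule poly0[OF h(1)]) (rule mon0)
  ultimately show False using s h by simp
qed

section \<open>Counting boxes with an interior zero\<close>

text \<open>Half-widths that vanish outside \<open>J\<close>: for positive
  \<open>\<epsilon>\<close>, \<open>facebox\<close> is then a cube of dimension
  \<open>card J\<close> and side \<open>2 * \<epsilon>\<close>, placed in the full space so that all
  faces share one type.\<close>

definition half_diag :: "real \<Rightarrow> 'n set \<Rightarrow> real ^ 'n" where
  "half_diag \<epsilon> J = (\<chi> i. if i \<in> J then \<epsilon> else 0)"

abbreviation facebox :: "real \<Rightarrow> 'n set \<Rightarrow> real ^ 'n \<Rightarrow> (real ^ 'n) set" where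
  "facebox \<epsilon> J x \<equiv> cbox (x - half_diag \<epsilon> J) (x + half_diag \<epsilon> J)"

lemma mem_facebox:
  assumes "\<epsilon> > 0"
  shows "z \<in> facebox \<epsilon> J x \<longleftrightarrow> (\<forall>i. if i \<in> J then \<bar>z $ i - x $ i\<bar> \<le> \<epsilon> else z $ i = x $ i)"
proof -
  have "(x - half_diag \<epsilon> J) $ i \<le> z $ i \<and> z $ i \<le> (x + half_diag \<epsilon> J) $ i \<longleftrightarrow>
      (if i \<in> J then \<bar>z $ i - x $ i\<bar> \<le> \<epsilon> else z $ i = x $ i)" for i
    by (auto simp: half_diag_def abs_le_iff)
  then show ?thesis unfolding mem_box_cart by blast
qed

text \<open>The perturbation in the proof adds a small multiple of \<open>\<Sum>\<^sub>i y\<^sub>i\<^bsup>d+1\<^esup>\<close>: it keeps a minimum in the interior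
  of each box and turns the critical equations into a system as in \<open>card_expoly_system_le\<close>.\<close>

lemma expoly_box_count:
  fixes T :: "(real ^ 'n::finite) set"
  assumes "q > 0" "\<epsilon> > 0" "finite T" and P: "P \<in> expoly q J d"
    and sep: "\<And>s t. s \<in> T \<Longrightarrow> t \<in> T \<Longrightarrow> s \<noteq> t \<Longrightarrow> \<exists>i\<in>J. \<bar>s $ i - t $ i\<bar> > 2 * \<epsilon>"
    and zero: "\<And>t. t \<in> T \<Longrightarrow> \<exists>z\<in>facebox \<epsilon> J t. P z = 0"
    and pos: "\<And>t z i. t \<in> T \<Longrightarrow> z \<in> facebox \<epsilon> J t \<Longrightarrow> i \<in> J \<Longrightarrow> \<bar>z $ i - t $ i\<bar> = \<epsilon> \<Longrightarrow> P z > 0"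
  shows "card T \<le> Suc d ^ card J"
proof -
  obtain z0 where z0: "\<And>t. t \<in> T \<Longrightarrow> z0 t \<in> facebox \<epsilon> J t \<and> P (z0 t) = 0"
    using zero by metis
  \<comment> \<open>The relative boundary of the box. Being compact, it carries a positive lower
    bound \<open>m t\<close> for \<open>P\<close>.\<close>
  define bd where "bd = (\<lambda>t. facebox \<epsilon> J t \<inter> (\<Union>i\<in>J. {z. \<bar>z $ i - t $ i\<bar> = \<epsilon>}))"
  have "compact (bd t)" for t
  proof -
    have "closed (\<Union>i\<in>J. {z::real^'n. \<bar>z $ i - t $ i\<bar> = \<epsilon>})"
      by (intro closed_UN finite ballI closed_Collect_eq continuous_intros)
    then show ?thesis unfolding bd_def by (intro compact_Int_closed) auto
  qed
  have "\<exists>m>0. \<forall>z\<in>bd t. P z \<ge> m" if "t \<in> T" for t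
  proof (cases "bd t = {}")
    case True
    then show ?thesis by (intro exI[of _ 1]) auto
  next
    case False
    then obtain y where "y \<in> bd t" "\<forall>z\<in>bd t. P y \<le> P z"
      using continuous_attains_inf[OF \<open>compact (bd t)\<close> _ expoly_continuous[OF P]] by blast
    then show ?thesis using pos[OF that] by (intro exI[of _ "P y"]) (auto simp: bd_def)
  qed
  then obtain m where m: "\<And>t. t \<in> T \<Longrightarrow> m t > 0" "\<And>t z. t \<in> T \<Longrightarrow> z \<in> bd t \<Longrightarrow> P z \<ge> m t"
    by metis
  define pert :: "real ^ 'n \<Rightarrow> real" where "pert = (\<lambda>z. \<Sum>i\<in>J. exp (real (Suc d) * z $ i / q))"
  \<comment> \<open>One \<open>\<eta>\<close> has to serve all boxes at once; as \<open>T\<close> is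
    finite, every sufficiently small positive value will do.\<close>
  have "\<forall>\<^sub>F \<eta> in at_right 0. \<forall>t\<in>T. \<eta> * pert (z0 t) < m t"
  proof (rule eventually_ball_finite[OF \<open>finite T\<close>], rule ballI)
    fix t assume "t \<in> T"
    have "((\<lambda>\<eta>. \<eta> * pert (z0 t)) \<longlongrightarrow> 0 * pert (z0 t)) (at_right 0)"
      by (intro tendsto_intros)
    with m(1)[OF \<open>t \<in> T\<close>] show "\<forall>\<^sub>F \<eta> in at_right 0. \<eta> * pert (z0 t) < m t"
      by (intro order_tendstoD) auto
  qed
  moreover have "\<forall>\<^sub>F \<eta> in at_right (0::real). \<eta> > 0"
    by (rule eventually_at_right_less)
  ultimately have "\<forall>\<^sub>F \<eta> in at_right 0. \<eta> > 0 \<and> (\<forall>t\<in>T. \<eta> * pert (z0 t) < m t)"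
    by eventually_elim auto
  then obtain \<eta> where \<eta>: "\<eta> > 0" "\<And>t. t \<in> T \<Longrightarrow> \<eta> * pert (z0 t) < m t"
    using eventually_happens'[OF trivial_limit_at_right_real] by blast
  define \<Phi> where "\<Phi> = (\<lambda>z. P z + \<eta> * pert z)"
  have cont: "continuous_on A \<Phi>" for A
    unfolding \<Phi>_def pert_def using \<open>q > 0\<close>
    by (intro continuous_intros expoly_continuous[OF P]) auto
  have "\<exists>z\<in>facebox \<epsilon> J t. (\<forall>y\<in>facebox \<epsilon> J t. \<Phi> z \<le> \<Phi> y)" if "t \<in> T" for t
    using z0[OF that] by (intro continuous_attains_inf cont) auto
  then obtain zm where zm: "\<And>t. t \<in> T \<Longrightarrow> zm t \<in> facebox \<epsilon> J t"
    "\<And>t y. t \<in> T \<Longrightarrow> y \<in> facebox \<epsilon> J t \<Longrightarrow> \<Phi> (zm t) \<le> \<Phi> y"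
    by metis
  have interior: "\<bar>zm t $ i - t $ i\<bar> < \<epsilon>" if "t \<in> T" "i \<in> J" for t i
  proof (rule ccontr)
    assume "\<not> ?thesis"
    moreover have "\<bar>zm t $ i - t $ i\<bar> \<le> \<epsilon>"
      using zm(1)[OF that(1)] that(2) unfolding mem_facebox[OF \<open>\<epsilon> > 0\<close>] by meson
    ultimately have "\<bar>zm t $ i - t $ i\<bar> = \<epsilon>" by linarith
    with zm(1)[OF that(1)] that have "zm t \<in> bd t" by (auto simp: bd_def)
    then have "m t \<le> P (zm t)" using m(2) that by blast
    also have "\<dots> \<le> \<Phi> (zm t)"
      using \<eta>(1) by (auto simp: \<Phi>_def pert_def intro!: sum_nonneg mult_nonneg_nonneg)
    also have "\<dots> \<le> \<Phi> (z0 t)" using zm(2) z0 that by blast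
    also have "\<dots> < m t" using \<eta>(2) z0 that by (simp add: \<Phi>_def)
    finally show False by simp
  qed
  obtain P' where P': "\<And>i. P' i \<in> expoly q J d"
    "\<And>i x. ((\<lambda>t. P (x + t *\<^sub>R axis i 1)) has_real_derivative P' i x) (at 0)"
    using expoly_derivative[OF P] by metis
  have crit: "exp (real (Suc d) * zm t $ i / q) = - (q / (\<eta> * real (Suc d))) * P' i (zm t)"
    if "t \<in> T" "i \<in> J" for t i
  proof -
    have pert_eq: "pert (zm t + s *\<^sub>R axis i 1) =
        exp (real (Suc d) * (zm t $ i + s) / q) + (\<Sum>l\<in>J - {i}. exp (real (Suc d) * zm t $ l / q))" for s
    proof -
      have "pert (zm t + s *\<^sub>R axis i 1) =
        exp (real (Suc d) * (zm t $ i + s) / q)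
        + (\<Sum>l\<in>J - {i}. exp (real (Suc d) * (zm t + s *\<^sub>R axis i 1) $ l / q))"
        unfolding pert_def by (subst sum.remove[OF _ that(2)]) auto
      also have "(\<Sum>l\<in>J - {i}. exp (real (Suc d) * (zm t + s *\<^sub>R axis i 1) $ l / q))
        = (\<Sum>l\<in>J - {i}. exp (real (Suc d) * zm t $ l / q))"
        by (rule sum.cong) (auto simp: axis_def)
      finally show ?thesis .
    qed
    have "((\<lambda>s. pert (zm t + s *\<^sub>R axis i 1)) has_real_derivative
        (real (Suc d) / q * exp (real (Suc d) * zm t $ i / q))) (at 0)"
      unfolding pert_eq by (rule derivative_eq_intros refl | use \<open>q > 0\<close> in simp)+
    then have "((\<lambda>s. \<Phi> (zm t + s *\<^sub>R axis i 1)) has_real_derivative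
        P' i (zm t) + \<eta> * (real (Suc d) / q * exp (real (Suc d) * zm t $ i / q))) (at 0)"
      unfolding \<Phi>_def by (intro DERIV_add P' DERIV_cmult)
    \<comment> \<open>The radius is the distance from the minimizer to the nearer of the two sides
      in direction \<open>i\<close>, so such moves stay in the box.\<close>
    moreover have "\<forall>s. \<bar>0 - s\<bar> < \<epsilon> - \<bar>zm t $ i - t $ i\<bar> \<longrightarrow>
        \<Phi> (zm t + 0 *\<^sub>R axis i 1) \<le> \<Phi> (zm t + s *\<^sub>R axis i 1)"
    proof (intro allI impI)
      fix s assume s: "\<bar>0 - s\<bar> < \<epsilon> - \<bar>zm t $ i - t $ i\<bar>"
      have "zm t + s *\<^sub>R axis i 1 \<in> facebox \<epsilon> J t"
        unfolding mem_facebox[OF \<open>\<epsilon> > 0\<close>]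
      proof
        fix l
        show "if l \<in> J then \<bar>(zm t + s *\<^sub>R axis i 1) $ l - t $ l\<bar> \<le> \<epsilon>
          else (zm t + s *\<^sub>R axis i 1) $ l = t $ l"
          using s zm(1)[OF that(1)] that(2) unfolding mem_facebox[OF \<open>\<epsilon> > 0\<close>]
          by (cases "l = i") (auto simp: axis_def dest: spec[of _ l])
      qed
      then show "\<Phi> (zm t + 0 *\<^sub>R axis i 1) \<le> \<Phi> (zm t + s *\<^sub>R axis i 1)"
        using zm(2) that by simp
    qed
    ultimately have "P' i (zm t) + \<eta> * (real (Suc d) / q * exp (real (Suc d) * zm t $ i / q)) = 0"
      using interior[OF that] by (intro DERIV_local_min[of _ _ 0 "\<epsilon> - \<bar>zm t $ i - t $ i\<bar>"]) auto
    then show ?thesis using \<eta>(1) \<open>q > 0\<close> by (simp add: field_simps del: of_nat_Suc)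
  qed
  \<comment> \<open>Minimizers stay strictly within \<open>\<epsilon>\<close> of their centres in
    each coordinate of \<open>J\<close>, so centres more than \<open>2 * \<epsilon>\<close> apart
    have different minimizers.\<close>
  have zm_sep: "\<exists>i\<in>J. zm s $ i \<noteq> zm t $ i" if "s \<in> T" "t \<in> T" "s \<noteq> t" for s t
  proof -
    from sep[OF that] obtain i where i: "i \<in> J" "\<bar>s $ i - t $ i\<bar> > 2 * \<epsilon>" by blast
    then show ?thesis using interior[of s i] interior[of t i] that by (intro bexI[of _ i]) linarith+
  qed
  then have "inj_on zm T" unfolding inj_on_def by metis
  then have "card T = card (zm ` T)" by (simp add: card_image)
  also have "\<dots> \<le> Suc d ^ card J"
  proof (rule card_expoly_system_le[OF \<open>q > 0\<close>])
    show "(\<lambda>x. - (q / (\<eta> * real (Suc d))) * P' i x) \<in> expoly q J d" for i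
      by (rule expoly_cmult[OF P'(1)])
    show "\<exists>i\<in>J. x $ i \<noteq> y $ i" if "x \<in> zm ` T" "y \<in> zm ` T" "y \<noteq> x" for x y
      using that zm_sep by blast
  qed (use crit \<open>finite T\<close> in \<open>auto simp del: of_nat_Suc\<close>)
  finally show ?thesis .
qed

section \<open>Volume bounds by averaging over a lattice\<close>

text \<open>The volumes of the pieces of \<open>E\<close> inside the translates of \<open>U\<close>
  add up to the integral over \<open>u \<in> U\<close> of the number of \<open>\<tau>\<close> with
  \<open>\<tau> + u \<in> E\<close>, and that number is at most \<open>N\<close>.\<close>

lemma emeasure_le_translates:
  fixes E U :: "'a::euclidean_space set"
  assumes "finite \<Lambda>" "E \<in> sets borel" "U \<in> sets borel"
    and cover: "E \<subseteq> (\<Union>\<tau>\<in>\<Lambda>. (+) \<tau> ` U)"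
    and mult: "\<And>u. u \<in> U \<Longrightarrow> card {\<tau>\<in>\<Lambda>. \<tau> + u \<in> E} \<le> N"
  shows "emeasure lborel E \<le> of_nat N * emeasure lborel U"
proof -
  define X where "X = (\<lambda>\<tau>. {x \<in> E. x - \<tau> \<in> U})"
  have [measurable]: "E \<in> sets borel" "U \<in> sets borel" by fact+
  have X: "X \<tau> \<in> sets borel" for \<tau> unfolding X_def by measurable
  have "E \<subseteq> (\<Union>\<tau>\<in>\<Lambda>. X \<tau>)" using cover by (force simp: X_def)
  then have "emeasure lborel E \<le> emeasure lborel (\<Union>\<tau>\<in>\<Lambda>. X \<tau>)"
    using X \<open>finite \<Lambda>\<close> by (intro emeasure_mono sets.finite_UN) auto
  also have "\<dots> \<le> (\<Sum>\<tau>\<in>\<Lambda>. emeasure lborel (X \<tau>))"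
    using X \<open>finite \<Lambda>\<close> by (intro emeasure_subadditive_finite) auto
  also have "\<dots> = (\<Sum>\<tau>\<in>\<Lambda>. \<integral>\<^sup>+u. indicator E (\<tau> + u) * indicator U u \<partial>lborel)"
  proof (rule sum.cong)
    fix \<tau>
    have "emeasure lborel (X \<tau>) = emeasure (distr lborel borel ((+) \<tau>)) (X \<tau>)"
      by (simp add: lborel_distr_plus)
    also have "\<dots> = emeasure lborel ((+) \<tau> -` X \<tau>)"
      using X by (subst emeasure_distr) auto
    also have "\<dots> = (\<integral>\<^sup>+u. indicator ((+) \<tau> -` X \<tau>) u \<partial>lborel)"
      using measurable_sets[of "(+) \<tau>" borel borel, OF _ X] by (subst nn_integral_indicator) auto
    also have "\<dots> = (\<integral>\<^sup>+u. indicator E (\<tau> + u) * indicator U u \<partial>lborel)"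
      by (intro nn_integral_cong) (auto simp: X_def indicator_def)
    finally show "emeasure lborel (X \<tau>) = (\<integral>\<^sup>+u. indicator E (\<tau> + u) * indicator U u \<partial>lborel)" .
  qed simp
  also have "\<dots> = (\<integral>\<^sup>+u. (\<Sum>\<tau>\<in>\<Lambda>. indicator E (\<tau> + u) * indicator U u) \<partial>lborel)"
    by (rule nn_integral_sum[symmetric]) measurable
  also have "\<dots> \<le> (\<integral>\<^sup>+u. of_nat N * indicator U u \<partial>lborel)"
  proof (rule nn_integral_mono)
    fix u
    have "(\<Sum>\<tau>\<in>\<Lambda>. indicator E (\<tau> + u)) = (of_nat (card {\<tau>\<in>\<Lambda>. \<tau> + u \<in> E}) :: ennreal)"
      using \<open>finite \<Lambda>\<close> by (simp add: indicator_def sum.If_cases Int_def)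
    then show "(\<Sum>\<tau>\<in>\<Lambda>. indicator E (\<tau> + u) * indicator U u) \<le> (of_nat N * indicator U u :: ennreal)"
      using mult[of u] by (auto simp: indicator_def)
  qed
  also have "\<dots> = of_nat N * emeasure lborel U"
    by (simp add: nn_integral_cmult)
  finally show ?thesis .
qed

text \<open>Here the translations form a lattice of mesh \<open>h\<close> in the directions
  \<open>J\<close>, and \<open>U\<close> contains \<open>E\<close> reduced modulo that lattice.
  Points of \<open>E\<close> in one class lie in a common \<open>J\<close>-plane and differ by at
  least \<open>h\<close> in some coordinate, so a count of separated points becomes a volume
  bound.\<close>

lemma emeasure_le_lattice:
  fixes E U :: "(real ^ 'n::finite) set"
  assumes "h > 0" "bounded E" "E \<in> sets borel" "U \<in> sets borel"
    and red: "\<And>x. x \<in> E \<Longrightarrow> (\<chi> i. if i \<in> J then x $ i - h * of_int \<lfloor>x $ i / h\<rfloor> else x $ i) \<in> U"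
    and mult: "\<And>u T. finite T \<Longrightarrow> T \<subseteq> E \<Longrightarrow> (\<And>t i. t \<in> T \<Longrightarrow> i \<notin> J \<Longrightarrow> t $ i = u $ i) \<Longrightarrow>
      (\<And>s t. s \<in> T \<Longrightarrow> t \<in> T \<Longrightarrow> s \<noteq> t \<Longrightarrow> \<exists>i\<in>J. \<bar>s $ i - t $ i\<bar> \<ge> h) \<Longrightarrow> card T \<le> N"
  shows "emeasure lborel E \<le> of_nat N * emeasure lborel U"
proof -
  obtain R where R: "\<And>x. x \<in> E \<Longrightarrow> norm x \<le> R"
    using \<open>bounded E\<close> by (auto simp: bounded_iff)
  \<comment> \<open>Boundedness of \<open>E\<close> leaves finitely many lattice vectors; the
    summand 1 allows for rounding down on the negative side.\<close>
  define M where "M = \<lceil>R / h\<rceil> + 1"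
  define lat :: "('n \<Rightarrow> int) \<Rightarrow> real ^ 'n"
    where "lat = (\<lambda>k. \<chi> i. if i \<in> J then h * of_int (k i) else 0)"
  define \<Lambda> where "\<Lambda> = lat ` (PiE UNIV (\<lambda>_. {-M..M}))"
  have "finite \<Lambda>" unfolding \<Lambda>_def by (intro finite_imageI finite_PiE) auto
  show ?thesis
  proof (rule emeasure_le_translates[OF \<open>finite \<Lambda>\<close> assms(3,4)])
    show "E \<subseteq> (\<Union>\<tau>\<in>\<Lambda>. (+) \<tau> ` U)"
    proof
      fix x assume x: "x \<in> E"
      have "lat (\<lambda>i. \<lfloor>x $ i / h\<rfloor>) \<in> \<Lambda>"
        unfolding \<Lambda>_def
      proof (intro imageI PiE_I)
        fix i :: 'n
        have "\<bar>x $ i\<bar> \<le> R" using component_le_norm_cart[of x i] R[OF x] by linarith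
        then have "x $ i / h \<le> R / h" "- (R / h) \<le> x $ i / h"
          using \<open>h > 0\<close> by (auto simp: field_simps)
        then show "\<lfloor>x $ i / h\<rfloor> \<in> {-M..M}" unfolding M_def by simp linarith
      qed simp
      moreover have "x = lat (\<lambda>i. \<lfloor>x $ i / h\<rfloor>) +
          (\<chi> i. if i \<in> J then x $ i - h * of_int \<lfloor>x $ i / h\<rfloor> else x $ i)"
        by (simp add: vec_eq_iff lat_def)
      ultimately show "x \<in> (\<Union>\<tau>\<in>\<Lambda>. (+) \<tau> ` U)" using red[OF x] by blast
    qed
  next
    fix u
    define T where "T = (\<lambda>\<tau>. \<tau> + u) ` {\<tau>\<in>\<Lambda>. \<tau> + u \<in> E}"
    have "card {\<tau>\<in>\<Lambda>. \<tau> + u \<in> E} = card T"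
      unfolding T_def by (intro card_image[symmetric]) (auto simp: inj_on_def)
    also have "\<dots> \<le> N"
    proof (rule mult[of _ u])
      show "finite T" "T \<subseteq> E" using \<open>finite \<Lambda>\<close> by (auto simp: T_def)
      show "t $ i = u $ i" if "t \<in> T" "i \<notin> J" for t i
        using that by (auto simp: T_def \<Lambda>_def lat_def)
      fix s t assume st: "s \<in> T" "t \<in> T" "s \<noteq> t"
      then obtain k l where kl: "s = lat k + u" "t = lat l + u"
        by (auto simp: T_def \<Lambda>_def)
      with st have "lat k \<noteq> lat l" by auto
      then obtain i where i: "i \<in> J" "k i \<noteq> l i"
        by (auto simp: lat_def vec_eq_iff split: if_splits)
      have "\<bar>s $ i - t $ i\<bar> = h * of_int \<bar>k i - l i\<bar>"
        using i(1) \<open>h > 0\<close> by (simp add: kl lat_def right_diff_distrib[symmetric] abs_mult)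
      moreover have "\<bar>k i - l i\<bar> \<ge> 1" using i(2) by simp
      then have "h * of_int \<bar>k i - l i\<bar> \<ge> h * 1"
        using \<open>h > 0\<close> by (intro mult_left_mono) linarith+
      ultimately show "\<exists>i\<in>J. \<bar>s $ i - t $ i\<bar> \<ge> h" using i(1) by (intro bexI[of _ i]) simp_all
    qed
    finally show "card {\<tau>\<in>\<Lambda>. \<tau> + u \<in> E} \<le> N" .
  qed
qed

section \<open>Sigmoid networks as exponential rational functions\<close>

text \<open>Parametrizes the coordinate plane through \<open>u\<close> with directions
  \<open>J\<close>, while \<open>z\<close> still ranges over the full space.\<close>

definition merge_coords :: "'n set \<Rightarrow> real ^ 'n \<Rightarrow> real ^ 'n \<Rightarrow> real ^ 'n" where
  "merge_coords J z u = (\<chi> i. if i \<in> J then z $ i else u $ i)"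

text \<open>On every coordinate plane, \<open>f\<close> is a quotient of exponential polynomials with positive
  denominator; the degree is at most \<open>D\<close> for each free coordinate.\<close>

definition exp_rational :: "real \<Rightarrow> nat \<Rightarrow> (real ^ 'n::finite \<Rightarrow> real) \<Rightarrow> bool" where
  "exp_rational q D f \<longleftrightarrow> (\<forall>J u. \<exists>H\<in>expoly q J (card J * D). (\<forall>z. H z > 0) \<and>
    (\<lambda>z. f (merge_coords J z u) * H z) \<in> expoly q J (card J * D))"

lemma exp_rational_const: "exp_rational q 0 (\<lambda>x. c)"
  unfolding exp_rational_def
proof (intro allI bexI conjI)
  show "(\<lambda>z. c * 1) \<in> expoly q J (card J * 0)" "(\<lambda>z. 1) \<in> expoly q J (card J * 0)" for J :: "'a set"
    using expoly_const by auto
qed simp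

text \<open>Over the product of the two denominators, each numerator is multiplied by the other
  denominator, so the degrees add and positivity is kept.\<close>

lemma exp_rational_add:
  assumes "exp_rational q D f" "exp_rational q E g"
  shows "exp_rational q (D + E) (\<lambda>x. f x + g x)"
  unfolding exp_rational_def
proof (intro allI)
  fix J u
  obtain H where H: "H \<in> expoly q J (card J * D)" "\<And>z. H z > 0"
    "(\<lambda>z. f (merge_coords J z u) * H z) \<in> expoly q J (card J * D)"
    using assms(1) unfolding exp_rational_def by meson
  obtain K where K: "K \<in> expoly q J (card J * E)" "\<And>z. K z > 0"
    "(\<lambda>z. g (merge_coords J z u) * K z) \<in> expoly q J (card J * E)"
    using assms(2) unfolding exp_rational_def by meson
  have "(\<lambda>z. H z * K z) \<in> expoly q J (card J * (D + E))"
    using expoly_mult[OF H(1) K(1)] by (simp add: algebra_simps)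
  moreover have "(\<lambda>z. (f (merge_coords J z u) + g (merge_coords J z u)) * (H z * K z))
      \<in> expoly q J (card J * (D + E))"
    using expoly_add[OF expoly_mult[OF H(3) K(1)] expoly_mult[OF H(1) K(3)]]
    by (simp add: algebra_simps)
  ultimately show "\<exists>H\<in>expoly q J (card J * (D + E)). (\<forall>z. H z > 0) \<and>
    (\<lambda>z. (f (merge_coords J z u) + g (merge_coords J z u)) * H z) \<in> expoly q J (card J * (D + E))"
    using H(2) K(2) by (intro bexI[of _ "\<lambda>z. H z * K z"]) auto
qed

text \<open>With the integers \<open>q * a $ i\<close> split into positive and negative parts,
  multiplying through by the monomial \<open>expmon q mp\<close> turns the sigmoid into
  \<open>expmon q mp / H\<close>. Negative exponents disappear, and each free coordinate costs at
  most \<open>L\<close> in degree.\<close>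

lemma exp_rational_logistic:
  fixes a :: "real ^ 'n::finite"
  assumes "q > 0" and int: "\<And>i. q * a $ i \<in> \<int>" and bound: "\<And>i. \<bar>q * a $ i\<bar> \<le> real L"
  shows "exp_rational q L (\<lambda>x. d * logistic (a \<bullet> x + b))"
  unfolding exp_rational_def
proof (intro allI)
  fix J :: "'n set" and u :: "real ^ 'n"
  define m where "m = (\<lambda>i. \<lfloor>q * a $ i\<rfloor>)"
  have m: "q * a $ i = of_int (m i)" for i
    using int[of i] by (auto simp: m_def elim: Ints_cases)
  define mp where "mp = (\<lambda>i. if i \<in> J then nat (m i) else 0)"
  define mn where "mn = (\<lambda>i. if i \<in> J then nat (- m i) else 0)"
  define B where "B = (\<Sum>i\<in>UNIV. if i \<in> J then 0 else a $ i * u $ i)"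
  define H where "H = (\<lambda>z. 1 * expmon q mp z + exp (- (B + b)) * expmon q mn z)"
  have deg: "(\<Sum>i\<in>UNIV. k i) \<le> card J * L" if "\<And>i. k i \<le> (if i \<in> J then L else 0)" for k :: "'n \<Rightarrow> nat"
  proof -
    have "(\<Sum>i\<in>UNIV. k i) \<le> (\<Sum>i\<in>UNIV. if i \<in> J then L else 0)"
      by (rule sum_mono) (rule that)
    then show ?thesis by (simp add: sum.If_cases)
  qed
  have "\<bar>m i\<bar> \<le> int L" for i using bound[of i] unfolding m by linarith
  then have "nat (m i) \<le> L" "nat (- m i) \<le> L" for i
    by (simp_all add: abs_le_iff nat_le_iff)
  then have "mp i \<le> (if i \<in> J then L else 0)" "mn i \<le> (if i \<in> J then L else 0)" for i
    by (auto simp: mp_def mn_def)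
  note deg' = deg[OF this(1)] deg[OF this(2)]
  have mon: "(\<lambda>z. c * expmon q mp z) \<in> expoly q J (card J * L)"
     "(\<lambda>z. c * expmon q mn z) \<in> expoly q J (card J * L)" for c
    using deg' by (auto simp: mp_def mn_def intro!: expoly_mon)
  have "H \<in> expoly q J (card J * L)"
    unfolding H_def by (intro expoly_add mon)
  moreover have pos: "H z > 0" for z by (simp add: H_def expmon_def add_pos_pos)
  moreover have "(\<lambda>z. d * logistic (a \<bullet> merge_coords J z u + b) * H z) = (\<lambda>z. d * expmon q mp z)"
  proof
    fix z
    have "a \<bullet> merge_coords J z u
        = (\<Sum>i\<in>UNIV. (real (mp i) * z $ i - real (mn i) * z $ i) / q + (if i \<in> J then 0 else a $ i * u $ i))"
      unfolding inner_vec_def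
    proof (rule sum.cong)
      fix i
      have "a $ i = (real (nat (m i)) - real (nat (- m i))) / q"
        using m[of i] \<open>q > 0\<close> by (simp add: field_simps)
      then show "a $ i \<bullet> merge_coords J z u $ i
        = (real (mp i) * z $ i - real (mn i) * z $ i) / q + (if i \<in> J then 0 else a $ i * u $ i)"
        by (auto simp: merge_coords_def mp_def mn_def left_diff_distrib diff_divide_distrib)
    qed simp
    also have "\<dots> = (\<Sum>i\<in>UNIV. real (mp i) * z $ i) / q - (\<Sum>i\<in>UNIV. real (mn i) * z $ i) / q + B"
      by (simp add: B_def sum.distrib sum_subtractf sum_divide_distrib diff_divide_distrib)
    finally have "exp (- (a \<bullet> merge_coords J z u + b)) * expmon q mp z = exp (- (B + b)) * expmon q mn z"
      by (simp add: expmon_def exp_add[symmetric])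
    then have "H z = (1 + exp (- (a \<bullet> merge_coords J z u + b))) * expmon q mp z"
      by (simp add: H_def algebra_simps)
    moreover have "1 + exp (- (a \<bullet> merge_coords J z u + b)) > 0" by (simp add: add_pos_pos)
    ultimately show "d * logistic (a \<bullet> merge_coords J z u + b) * H z = d * expmon q mp z"
      by (simp add: logistic_def)
  qed
  ultimately show "\<exists>H\<in>expoly q J (card J * L). (\<forall>z. H z > 0) \<and>
      (\<lambda>z. d * logistic (a \<bullet> merge_coords J z u + b) * H z) \<in> expoly q J (card J * L)"
    using mon(1)[of d] by (intro bexI[of _ H]) auto
qed

lemma exp_rational_network:
  fixes a :: "nat \<Rightarrow> real ^ 'n::finite"
  assumes "q > 0" "\<And>k i. k \<in> {1..w} \<Longrightarrow> q * a k $ i \<in> \<int>"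
    "\<And>k i. k \<in> {1..w} \<Longrightarrow> \<bar>q * a k $ i\<bar> \<le> real L"
  shows "exp_rational q (L * w) (\<lambda>x. c0 + (\<Sum>k = 1..w. d k * logistic (a k \<bullet> x + b k)))"
  using assms(2,3)
proof (induction w)
  case 0
  then show ?case using exp_rational_const by simp
next
  case (Suc w)
  have "exp_rational q (L * w + L) (\<lambda>x. (c0 + (\<Sum>k = 1..w. d k * logistic (a k \<bullet> x + b k)))
      + d (Suc w) * logistic (a (Suc w) \<bullet> x + b (Suc w)))"
    using Suc by (intro exp_rational_add exp_rational_logistic \<open>q > 0\<close>) auto
  then show ?case by (simp add: algebra_simps)
qed

text \<open>For \<open>J = UNIV\<close> merging is the identity, so \<open>f\<close> itself is a
  quotient of continuous functions.\<close>

lemma exp_rational_continuous: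
  assumes "exp_rational q D f"
  shows "continuous_on A f"
proof -
  obtain H where H: "H \<in> expoly q UNIV (card (UNIV :: 'a set) * D)" "\<And>z. H z > 0"
    "(\<lambda>z. f (merge_coords UNIV z 0) * H z) \<in> expoly q UNIV (card (UNIV :: 'a set) * D)"
    using assms unfolding exp_rational_def by meson
  have nz: "H z \<noteq> 0" for z using H(2)[of z] by simp
  have "continuous_on A (\<lambda>z. f z * H z / H z)"
    using nz expoly_continuous[OF H(1)] expoly_continuous[OF H(3)]
    by (intro continuous_on_divide) (auto simp: merge_coords_def)
  then show ?thesis by (simp add: nz)
qed

section \<open>Counting separated edges and faces that meet the zero set\<close>

text \<open>On a line parallel to axis \<open>i\<close> the numerator is a polynomial of degree at
  most \<open>D\<close> in the single variable \<open>y\<^sub>i\<close>. Separated edges contain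
  different zeros, hence different roots.\<close>

lemma edge_count:
  fixes T :: "(real ^ 'n::finite) set"
  assumes "q > 0" "\<epsilon> > 0" "exp_rational q D f" "bounded (zero_set f)" "finite T"
    and outside: "\<And>t l. t \<in> T \<Longrightarrow> l \<notin> {i} \<Longrightarrow> t $ l = u $ l"
    and sep: "\<And>s t. s \<in> T \<Longrightarrow> t \<in> T \<Longrightarrow> s \<noteq> t \<Longrightarrow> \<bar>s $ i - t $ i\<bar> > 2 * \<epsilon>"
    and zero: "\<And>t. t \<in> T \<Longrightarrow> \<exists>z\<in>facebox \<epsilon> {i} t. z \<in> zero_set f"
  shows "card T \<le> D"
proof -
  obtain H where H: "\<And>z. H z > 0" "(\<lambda>z. f (merge_coords {i} z u) * H z) \<in> expoly q {i} (card {i} * D)"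
    using assms(3) unfolding exp_rational_def by meson
  then obtain P where P: "degree P \<le> D" "\<And>z. f (merge_coords {i} z u) * H z = poly P (exp (z $ i / q))"
    using expoly_singleton_poly[of _ q i D] by fastforce
  \<comment> \<open>Otherwise the whole line would lie in the zero set, which is bounded.\<close>
  have "P \<noteq> 0"
  proof
    assume "P = 0"
    with P(2) H(1) have f0: "f (merge_coords {i} z u) = 0" for z
      by (metis less_irrefl mult_eq_0_iff poly_0)
    obtain R where R: "\<And>x. x \<in> zero_set f \<Longrightarrow> norm x \<le> R"
      using \<open>bounded (zero_set f)\<close> by (auto simp: bounded_iff)
    have "norm (merge_coords {i} ((\<bar>R\<bar> + 1) *\<^sub>R axis i 1) u) \<le> R"
      using f0 by (intro R) (simp add: zero_set_def)
    moreover have "\<bar>R\<bar> + 1 \<le> norm (merge_coords {i} ((\<bar>R\<bar> + 1) *\<^sub>R axis i 1) u)"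
      using component_le_norm_cart[of "merge_coords {i} ((\<bar>R\<bar> + 1) *\<^sub>R axis i 1) u" i]
      by (simp add: merge_coords_def)
    ultimately show False by linarith
  qed
  obtain z where z: "\<And>t. t \<in> T \<Longrightarrow> z t \<in> facebox \<epsilon> {i} t \<and> z t \<in> zero_set f"
    using zero by metis
  have "inj_on (\<lambda>t. exp (z t $ i / q)) T"
  proof (rule inj_onI, rule ccontr)
    fix s t assume st: "s \<in> T" "t \<in> T" "exp (z s $ i / q) = exp (z t $ i / q)" "s \<noteq> t"
    then have "z s $ i = z t $ i" using \<open>q > 0\<close> by simp
    moreover have "\<bar>z s $ i - s $ i\<bar> \<le> \<epsilon>" "\<bar>z t $ i - t $ i\<bar> \<le> \<epsilon>"
      using z st unfolding mem_facebox[OF \<open>\<epsilon> > 0\<close>] by (metis singletonI)+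
    ultimately show False using sep[of s t] st by linarith
  qed
  then have "card T = card ((\<lambda>t. exp (z t $ i / q)) ` T)" by (simp add: card_image)
  also have "\<dots> \<le> card {x. poly P x = 0}"
  proof (rule card_mono[OF poly_roots_finite[OF \<open>P \<noteq> 0\<close>]], safe)
    fix t assume t: "t \<in> T"
    have "merge_coords {i} (z t) u = z t"
      using z[OF t] outside[OF t] unfolding mem_facebox[OF \<open>\<epsilon> > 0\<close>]
      by (auto simp: merge_coords_def vec_eq_iff)
    then show "poly P (exp (z t $ i / q)) = 0"
      using P(2)[of "z t"] z[OF t] by (simp add: zero_set_def)
  qed
  also have "\<dots> \<le> degree P" by (rule card_poly_roots_bound[OF \<open>P \<noteq> 0\<close>])
  finally show ?thesis using P(1) by linarith
qed

text \<open>Squaring the numerator makes zeros into minima and gives positivity on the relative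
  boundary, as \<open>expoly_box_count\<close> requires; the price is the factor 2 in the
  degree.\<close>

lemma face_count:
  fixes T :: "(real ^ 'n::finite) set"
  assumes "q > 0" "\<epsilon> > 0" "exp_rational q D f" "finite T"
    and outside: "\<And>t l. t \<in> T \<Longrightarrow> l \<notin> J \<Longrightarrow> t $ l = u $ l"
    and sep: "\<And>s t. s \<in> T \<Longrightarrow> t \<in> T \<Longrightarrow> s \<noteq> t \<Longrightarrow> \<exists>i\<in>J. \<bar>s $ i - t $ i\<bar> > 2 * \<epsilon>"
    and zero: "\<And>t. t \<in> T \<Longrightarrow> \<exists>z\<in>facebox \<epsilon> J t. z \<in> zero_set f"
    and bd: "\<And>t z i. t \<in> T \<Longrightarrow> z \<in> facebox \<epsilon> J t \<Longrightarrow> i \<in> J \<Longrightarrow> \<bar>z $ i - t $ i\<bar> = \<epsilon> \<Longrightarrow> z \<notin> zero_set f"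
  shows "card T \<le> Suc (2 * (card J * D)) ^ card J"
proof -
  obtain H where H: "\<And>z. H z > 0" "(\<lambda>z. f (merge_coords J z u) * H z) \<in> expoly q J (card J * D)"
    using assms(3) unfolding exp_rational_def by meson
  define P where "P = (\<lambda>z. (f (merge_coords J z u) * H z) * (f (merge_coords J z u) * H z))"
  have "P \<in> expoly q J (2 * (card J * D))"
    using expoly_mult[OF H(2) H(2)] by (simp add: P_def mult_2)
  moreover have merge: "merge_coords J z u = z" if "t \<in> T" "z \<in> facebox \<epsilon> J t" for z t
    using that outside[OF that(1)] unfolding mem_facebox[OF \<open>\<epsilon> > 0\<close>]
    by (auto simp: merge_coords_def vec_eq_iff split: if_splits)
  moreover have "P z > 0" if "t \<in> T" "z \<in> facebox \<epsilon> J t" "i \<in> J" "\<bar>z $ i - t $ i\<bar> = \<epsilon>" for t z i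
  proof -
    have "f z * H z \<noteq> 0" using bd[OF that] H(1)[of z] by (simp add: zero_set_def)
    then show ?thesis using merge[OF that(1,2)]
      unfolding P_def power2_eq_square[symmetric] by simp
  qed
  moreover have "\<exists>z\<in>facebox \<epsilon> J t. P z = 0" if "t \<in> T" for t
    using zero[OF that] merge[OF that] by (force simp: P_def zero_set_def)
  ultimately show ?thesis
    using assms(1,2,4) sep by (intro expoly_box_count[of q \<epsilon> T P]) auto
qed

section \<open>Cubes meeting the zero set\<close>

definition hit :: "real \<Rightarrow> 'n set \<Rightarrow> (real ^ 'n::finite) set \<Rightarrow> (real ^ 'n) set" where
  "hit \<epsilon> J V = {x. \<exists>z\<in>V. z \<in> facebox \<epsilon> J x}"

definition bd_hit :: "real \<Rightarrow> 'n set \<Rightarrow> (real ^ 'n::finite) set \<Rightarrow> (real ^ 'n) set" where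
  "bd_hit \<epsilon> J V = {x. \<exists>z\<in>V. z \<in> facebox \<epsilon> J x \<and> (\<exists>i\<in>J. \<bar>z $ i - x $ i\<bar> = \<epsilon>)}"

lemma facebox_shift: "z \<in> facebox \<epsilon> J x \<longleftrightarrow> z - x \<in> facebox \<epsilon> J 0"
  by (simp add: mem_box_cart algebra_simps)

text \<open>The set is the Minkowski difference of \<open>V\<close> and a box centred at 0.
  Compactness supplies Borel measurability and finite volume.\<close>

lemma compact_hit:
  assumes "compact V"
  shows "compact (hit \<epsilon> J V)"
proof -
  have "hit \<epsilon> J V = {x - y |x y. x \<in> V \<and> y \<in> facebox \<epsilon> J 0}"
  proof (intro set_eqI iffI)
    fix x assume "x \<in> hit \<epsilon> J V"
    then obtain z where "z \<in> V" "z - x \<in> facebox \<epsilon> J 0"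
      using facebox_shift unfolding hit_def by blast
    then show "x \<in> {x - y |x y. x \<in> V \<and> y \<in> facebox \<epsilon> J 0}"
      by (intro CollectI exI[of _ z] exI[of _ "z - x"]) simp
  next
    fix x assume "x \<in> {x - y |x y. x \<in> V \<and> y \<in> facebox \<epsilon> J 0}"
    then obtain z y where "x = z - y" "z \<in> V" "y \<in> facebox \<epsilon> J 0" by blast
    then show "x \<in> hit \<epsilon> J V"
      using facebox_shift[of z x \<epsilon> J] by (auto simp: hit_def intro!: bexI[of _ z])
  qed
  then show ?thesis using compact_differences[OF assms compact_cbox] by simp
qed

lemma compact_bd_hit:
  assumes "compact V"
  shows "compact (bd_hit \<epsilon> J V)"
proof -
  define K where "K = facebox \<epsilon> J 0 \<inter> (\<Union>i\<in>J. {z. \<bar>z $ i\<bar> = \<epsilon>})"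
  have "closed (\<Union>i\<in>J. {z::real^'a. \<bar>z $ i\<bar> = \<epsilon>})"
    by (intro closed_UN finite ballI closed_Collect_eq continuous_intros)
  then have "compact K" unfolding K_def by (intro compact_Int_closed) auto
  have "bd_hit \<epsilon> J V = {x - y |x y. x \<in> V \<and> y \<in> K}"
  proof (intro set_eqI iffI)
    fix x assume "x \<in> bd_hit \<epsilon> J V"
    then obtain z where "z \<in> V" "z - x \<in> K"
      using facebox_shift[of _ x \<epsilon> J] unfolding bd_hit_def K_def by fastforce
    then show "x \<in> {x - y |x y. x \<in> V \<and> y \<in> K}"
      by (intro CollectI exI[of _ z] exI[of _ "z - x"]) simp
  next
    fix x assume "x \<in> {x - y |x y. x \<in> V \<and> y \<in> K}"
    then obtain z y where "x = z - y" "z \<in> V" "y \<in> K" by blast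
    then show "x \<in> bd_hit \<epsilon> J V"
      using facebox_shift[of z x \<epsilon> J] by (auto simp: bd_hit_def K_def intro!: bexI[of _ z])
  qed
  then show ?thesis using compact_differences[OF assms \<open>compact K\<close>] by simp
qed

section \<open>Lattice cells and the volume of thin cylinders\<close>

lemma lattice_reduction_bounds:
  fixes h y :: real
  assumes "h > 0"
  shows "0 \<le> y - h * of_int \<lfloor>y / h\<rfloor>" "y - h * of_int \<lfloor>y / h\<rfloor> \<le> h"
proof -
  have "y / h - 1 \<le> of_int \<lfloor>y / h\<rfloor>" "of_int \<lfloor>y / h\<rfloor> \<le> y / h" by linarith+
  then have "h * (y / h - 1) \<le> h * of_int \<lfloor>y / h\<rfloor>" "h * of_int \<lfloor>y / h\<rfloor> \<le> h * (y / h)"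
    using assms by (intro mult_left_mono; simp)+
  then show "0 \<le> y - h * of_int \<lfloor>y / h\<rfloor>" "y - h * of_int \<lfloor>y / h\<rfloor> \<le> h"
    using assms by (simp_all add: right_diff_distrib)
qed

text \<open>One lattice cell along axis \<open>i\<close> times the projection of the ball along that
  axis; this is where the hits of edges in direction \<open>i\<close> land after reduction.\<close>

definition thin_cylinder :: "'n \<Rightarrow> real ^ 'n \<Rightarrow> real \<Rightarrow> real \<Rightarrow> (real ^ 'n::finite) set" where
  "thin_cylinder i p \<rho> h = {x. 0 \<le> x $ i \<and> x $ i \<le> h \<and> (\<Sum>l\<in>-{i}. (x $ l - p $ l)\<^sup>2) \<le> \<rho>\<^sup>2}"

lemma norm_sq_split:
  fixes x :: "real ^ 'n::finite"
  shows "(norm x)\<^sup>2 = (x $ i)\<^sup>2 + (\<Sum>l\<in>-{i}. (x $ l)\<^sup>2)"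
proof -
  have "(norm x)\<^sup>2 = (\<Sum>l\<in>UNIV. (x $ l)\<^sup>2)"
    unfolding power2_norm_eq_inner inner_vec_def by (simp add: power2_eq_square)
  then show ?thesis by (simp add: sum.remove[of UNIV i] Compl_eq_Diff_UNIV)
qed

lemma compact_thin_cylinder:
  assumes "\<rho> > 0" "h > 0"
  shows "compact (thin_cylinder i p \<rho> h)"
proof -
  have "closed (thin_cylinder i p \<rho> h)" unfolding thin_cylinder_def
    by (intro closed_Collect_conj closed_Collect_le continuous_intros)
  moreover have "bounded (thin_cylinder i p \<rho> h)"
  proof (rule bounded_subset[OF bounded_cbox])
    show "thin_cylinder i p \<rho> h \<subseteq> cbox (\<chi> l. if l = i then 0 else p $ l - \<rho>) (\<chi> l. if l = i then h else p $ l + \<rho>)"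
    proof
      fix x assume x: "x \<in> thin_cylinder i p \<rho> h"
      have *: "\<bar>x $ l - p $ l\<bar> \<le> \<rho>" if "l \<noteq> i" for l
      proof (rule power2_le_imp_le)
        have "(x $ l - p $ l)\<^sup>2 \<le> (\<Sum>l\<in>-{i}. (x $ l - p $ l)\<^sup>2)"
          using that by (intro member_le_sum) auto
        then show "\<bar>x $ l - p $ l\<bar>\<^sup>2 \<le> \<rho>\<^sup>2" using x by (auto simp: thin_cylinder_def)
      qed (use assms in auto)
      show "x \<in> cbox (\<chi> l. if l = i then 0 else p $ l - \<rho>) (\<chi> l. if l = i then h else p $ l + \<rho>)"
        unfolding mem_box_cart
      proof
        fix l
        show "(\<chi> l. if l = i then 0 else p $ l - \<rho>) $ l \<le> x $ l \<and>
            x $ l \<le> (\<chi> l. if l = i then h else p $ l + \<rho>) $ l"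
          using x *[of l] by (cases "l = i") (auto simp: thin_cylinder_def abs_le_iff)
      qed
    qed
  qed
  ultimately show ?thesis by (simp add: compact_eq_bounded_closed)
qed

text \<open>Stretch the height to \<open>6 \<rho> / 5\<close> and shrink the base to radius \<open>4 \<rho> / 5\<close>: since
  \<open>(3/5)\<^sup>2 + (4/5)\<^sup>2 = 1\<close>, the image fits into the ball.\<close>

lemma measure_thin_cylinder_le:
  fixes p :: "real ^ 'n::finite"
  assumes "\<rho> > 0" "h > 0"
  shows "measure lborel (thin_cylinder i p \<rho> h)
    \<le> 5 / 6 * (5 / 4) ^ (CARD('n) - 1) * (h / \<rho>) * measure lborel (cball p \<rho>)"
proof -
  define U where "U = thin_cylinder i p \<rho> h"
  define m where "m = (\<lambda>l. if l = i then 6 * \<rho> / (5 * h) else 4 / 5 :: real)"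
  \<comment> \<open>This translation recentres the stretched cylinder at \<open>p\<close>: the
    heights fill \<open>p $ i \<plusminus> 3 * \<rho> / 5\<close>, and the base shrinks towards
    \<open>p\<close>.\<close>
  define a where "a = (\<chi> l. if l = i then p $ i - 3 * \<rho> / 5 else p $ l / 5)"
  have U: "U \<in> lmeasurable"
    unfolding U_def by (intro lmeasurable_compact compact_thin_cylinder assms)
  have "prod m UNIV = m i * prod m (UNIV - {i})"
    by (rule prod.remove) auto
  also have "prod m (UNIV - {i}) = (4 / 5) ^ (CARD('n) - 1)"
    by (simp add: m_def card_Diff_singleton)
  finally have prod: "prod m UNIV = 6 * \<rho> / (5 * h) * (4 / 5) ^ (CARD('n) - 1)"
    by (simp add: m_def)
  have sub: "(+) a ` ((\<lambda>x. \<chi> k. m k * x $ k) ` U) \<subseteq> cball p \<rho>"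
  proof clarify
    fix x assume x: "x \<in> U"
    let ?y = "a + (\<chi> k. m k * x $ k) - p"
    have "(norm ?y)\<^sup>2 = (?y $ i)\<^sup>2 + (\<Sum>l\<in>-{i}. (?y $ l)\<^sup>2)" by (rule norm_sq_split)
    also have "(\<Sum>l\<in>-{i}. (?y $ l)\<^sup>2) = (\<Sum>l\<in>-{i}. (4 / 5)\<^sup>2 * (x $ l - p $ l)\<^sup>2)"
    proof (rule sum.cong)
      fix l assume "l \<in> - {i}"
      then have "?y $ l = 4 / 5 * (x $ l - p $ l)" by (simp add: a_def m_def field_simps)
      then show "(?y $ l)\<^sup>2 = (4 / 5)\<^sup>2 * (x $ l - p $ l)\<^sup>2" by (simp only: power_mult_distrib)
    qed simp
    also have "\<dots> \<le> (4 / 5)\<^sup>2 * \<rho>\<^sup>2"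
      using x by (simp add: sum_distrib_left[symmetric] U_def thin_cylinder_def)
    also have "(?y $ i)\<^sup>2 \<le> (3 * \<rho> / 5)\<^sup>2"
    proof (rule abs_le_square_iff[THEN iffD1])
      have "0 \<le> x $ i / h" "x $ i / h \<le> 1" using x assms by (auto simp: U_def thin_cylinder_def)
      then have "0 \<le> (6 * \<rho> / 5) * (x $ i / h)" "(6 * \<rho> / 5) * (x $ i / h) \<le> (6 * \<rho> / 5) * 1"
        using assms by (intro mult_nonneg_nonneg mult_left_mono; simp)+
      then have "\<bar>(6 * \<rho> / 5) * (x $ i / h) - 3 * \<rho> / 5\<bar> \<le> 3 * \<rho> / 5"
        by linarith
      then show "\<bar>?y $ i\<bar> \<le> \<bar>3 * \<rho> / 5\<bar>" using assms by (simp add: a_def m_def)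
    qed
    finally have "(norm ?y)\<^sup>2 \<le> \<rho>\<^sup>2" by (simp add: power2_eq_square)
    then have "norm ?y \<le> \<rho>" by (rule power2_le_imp_le) (use assms in simp)
    then show "a + (\<chi> k. m k * x $ k) \<in> cball p \<rho>"
      by (simp add: dist_norm norm_minus_commute)
  qed
  have "measure lebesgue ((+) a ` ((\<lambda>x. \<chi> k. m k * x $ k) ` U)) \<le> measure lebesgue (cball p \<rho>)"
    by (rule measure_mono_fmeasurable[OF sub]) (use measurable_translation[OF measurable_stretch[OF U]] in auto)
  then have "prod m UNIV * measure lebesgue U \<le> measure lebesgue (cball p \<rho>)"
    using assms by (simp add: measure_translation measure_stretch[OF U] prod abs_mult)
  moreover have "measure lebesgue U = measure lborel U"
    unfolding U_def by (intro measure_completion) (auto intro: borel_compact compact_thin_cylinder assms)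
  moreover have "measure lebesgue (cball p \<rho>) = measure lborel (cball p \<rho>)"
    by (intro measure_completion) auto
  ultimately have main: "6 * \<rho> / (5 * h) * (4 / 5) ^ (CARD('n) - 1) * measure lborel U \<le> measure lborel (cball p \<rho>)"
    by (simp add: prod)
  have "measure lborel U = 5 / 6 * (5 / 4) ^ (CARD('n) - 1) * (h / \<rho>) *
      (6 * \<rho> / (5 * h) * (4 / 5) ^ (CARD('n) - 1) * measure lborel U)"
    using assms by (simp add: field_simps power_mult_distrib[symmetric])
  also have "\<dots> \<le> 5 / 6 * (5 / 4) ^ (CARD('n) - 1) * (h / \<rho>) * measure lborel (cball p \<rho>)"
    using assms by (intro mult_left_mono[OF main]) auto
  finally show ?thesis unfolding U_def .
qed

text \<open>An edge agrees with its zero in all coordinates but \<open>i\<close>, so the base needs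
  radius only \<open>\<rho>\<close>, without an enlargement by \<open>\<epsilon>\<close>. Mesh
  \<open>4 * \<epsilon>\<close> exceeds the edge length \<open>2 * \<epsilon>\<close>, as strict
  separation demands.\<close>

lemma emeasure_hit_edge_le:
  fixes p :: "real ^ 'n::finite"
  assumes "q > 0" "\<epsilon> > 0" "\<rho> > 0" "exp_rational q D f" "compact (zero_set f)" "zero_set f \<subseteq> cball p \<rho>"
  shows "emeasure lborel (hit \<epsilon> {i} (zero_set f)) \<le> of_nat D * emeasure lborel (thin_cylinder i p \<rho> (4 * \<epsilon>))"
proof (rule emeasure_le_lattice[where h = "4 * \<epsilon>" and J = "{i}"])
  show "bounded (hit \<epsilon> {i} (zero_set f))" "hit \<epsilon> {i} (zero_set f) \<in> sets borel"
    using compact_hit[OF assms(5)] by (auto intro: compact_imp_bounded borel_compact)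
  show "thin_cylinder i p \<rho> (4 * \<epsilon>) \<in> sets borel"
    using assms by (intro borel_compact compact_thin_cylinder) auto
next
  fix x assume "x \<in> hit \<epsilon> {i} (zero_set f)"
  then obtain z where z: "z \<in> zero_set f" "z \<in> facebox \<epsilon> {i} x" by (auto simp: hit_def)
  have "(\<Sum>l\<in>-{i}. (x $ l - p $ l)\<^sup>2) = (\<Sum>l\<in>-{i}. ((z - p) $ l)\<^sup>2)"
    using z(2) unfolding mem_facebox[OF \<open>\<epsilon> > 0\<close>] by (intro sum.cong) auto
  also have "\<dots> \<le> (norm (z - p))\<^sup>2" by (simp add: norm_sq_split[of "z - p" i])
  also have "\<dots> \<le> \<rho>\<^sup>2"
    using z(1) assms(6) by (intro power_mono) (auto simp: dist_norm norm_minus_commute)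
  finally have "(\<Sum>l\<in>-{i}. (x $ l - p $ l)\<^sup>2) \<le> \<rho>\<^sup>2" .
  then show "(\<chi> l. if l \<in> {i} then x $ l - 4 * \<epsilon> * of_int \<lfloor>x $ l / (4 * \<epsilon>)\<rfloor> else x $ l)
      \<in> thin_cylinder i p \<rho> (4 * \<epsilon>)"
    using lattice_reduction_bounds[of "4 * \<epsilon>" "x $ i"] assms(2) by (simp add: thin_cylinder_def)
next
  fix u T
  assume T: "finite T" "T \<subseteq> hit \<epsilon> {i} (zero_set f)"
    "\<And>t l. t \<in> T \<Longrightarrow> l \<notin> {i} \<Longrightarrow> t $ l = u $ l"
    "\<And>s t. s \<in> T \<Longrightarrow> t \<in> T \<Longrightarrow> s \<noteq> t \<Longrightarrow> \<exists>i\<in>{i}. \<bar>s $ i - t $ i\<bar> \<ge> 4 * \<epsilon>"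
  show "card T \<le> D"
  proof (rule edge_count[OF assms(1,2,4) compact_imp_bounded[OF assms(5)] T(1,3)])
    show "\<bar>s $ i - t $ i\<bar> > 2 * \<epsilon>" if "s \<in> T" "t \<in> T" "s \<noteq> t" for s t
      using T(4)[OF that] assms(2) by auto
    show "\<exists>z\<in>facebox \<epsilon> {i} t. z \<in> zero_set f" if "t \<in> T" for t
      using T(2) that by (auto simp: hit_def)
  qed
qed (use assms in auto)

text \<open>The same averaging with a box of side \<open>2 * \<rho>\<close> as base: for terms of
  second order such a crude volume is enough.\<close>

lemma emeasure_hit_face_le:
  fixes p :: "real ^ 'n::finite"
  assumes "q > 0" "\<epsilon> > 0" "\<rho> > 0" "exp_rational q D f" "compact (zero_set f)" "zero_set f \<subseteq> cball p \<rho>"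
  shows "emeasure lborel (hit \<epsilon> J (zero_set f) - bd_hit \<epsilon> J (zero_set f))
    \<le> ennreal (real (Suc (2 * (card J * D)) ^ card J) * ((4 * \<epsilon>) ^ card J * (2 * \<rho>) ^ (CARD('n) - card J)))"
proof -
  define U where "U = cbox (\<chi> l. if l \<in> J then 0 else p $ l - \<rho>) (\<chi> l. if l \<in> J then 4 * \<epsilon> else p $ l + \<rho>)"
  have "emeasure lborel (hit \<epsilon> J (zero_set f) - bd_hit \<epsilon> J (zero_set f))
    \<le> of_nat (Suc (2 * (card J * D)) ^ card J) * emeasure lborel U"
  proof (rule emeasure_le_lattice[where h = "4 * \<epsilon>" and J = J])
    show "bounded (hit \<epsilon> J (zero_set f) - bd_hit \<epsilon> J (zero_set f))"
      using compact_hit[OF assms(5)] by (auto intro: compact_imp_bounded)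
    show "hit \<epsilon> J (zero_set f) - bd_hit \<epsilon> J (zero_set f) \<in> sets borel"
      by (intro sets.Diff borel_compact compact_hit compact_bd_hit assms(5))
    show "U \<in> sets borel" by (simp add: U_def)
  next
    fix x assume "x \<in> hit \<epsilon> J (zero_set f) - bd_hit \<epsilon> J (zero_set f)"
    then obtain z where z: "z \<in> zero_set f" "z \<in> facebox \<epsilon> J x" by (auto simp: hit_def)
    have *: "\<bar>x $ l - p $ l\<bar> \<le> \<rho>" if "l \<notin> J" for l
    proof -
      have "\<bar>(z - p) $ l\<bar> \<le> norm (z - p)" by (rule component_le_norm_cart)
      also have "\<dots> \<le> \<rho>" using z(1) assms(6) by (auto simp: dist_norm norm_minus_commute)
      finally show ?thesis using z(2) that unfolding mem_facebox[OF \<open>\<epsilon> > 0\<close>]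
        by (auto dest: spec[of _ l])
    qed
    show "(\<chi> l. if l \<in> J then x $ l - 4 * \<epsilon> * of_int \<lfloor>x $ l / (4 * \<epsilon>)\<rfloor> else x $ l) \<in> U"
      unfolding U_def mem_box_cart
    proof
      fix l
      let ?y = "x $ l - 4 * \<epsilon> * of_int \<lfloor>x $ l / (4 * \<epsilon>)\<rfloor>"
      have "0 \<le> ?y" "?y \<le> 4 * \<epsilon>"
        using lattice_reduction_bounds[of "4 * \<epsilon>" "x $ l"] assms(2) by simp_all
      then show "(\<chi> l. if l \<in> J then 0 else p $ l - \<rho>) $ l
          \<le> (\<chi> l. if l \<in> J then x $ l - 4 * \<epsilon> * of_int \<lfloor>x $ l / (4 * \<epsilon>)\<rfloor> else x $ l) $ l \<and>
          (\<chi> l. if l \<in> J then x $ l - 4 * \<epsilon> * of_int \<lfloor>x $ l / (4 * \<epsilon>)\<rfloor> else x $ l) $ l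
          \<le> (\<chi> l. if l \<in> J then 4 * \<epsilon> else p $ l + \<rho>) $ l"
        using *[of l] by (cases "l \<in> J") (auto simp: abs_le_iff)
    qed
  next
    fix u T
    assume T: "finite T" "T \<subseteq> hit \<epsilon> J (zero_set f) - bd_hit \<epsilon> J (zero_set f)"
      "\<And>t l. t \<in> T \<Longrightarrow> l \<notin> J \<Longrightarrow> t $ l = u $ l"
      "\<And>s t. s \<in> T \<Longrightarrow> t \<in> T \<Longrightarrow> s \<noteq> t \<Longrightarrow> \<exists>i\<in>J. \<bar>s $ i - t $ i\<bar> \<ge> 4 * \<epsilon>"
    show "card T \<le> Suc (2 * (card J * D)) ^ card J"
    proof (rule face_count[OF assms(1,2,4) T(1,3)])
      show "\<exists>i\<in>J. \<bar>s $ i - t $ i\<bar> > 2 * \<epsilon>" if "s \<in> T" "t \<in> T" "s \<noteq> t" for s t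
      proof -
        from T(4)[OF that] obtain i where "i \<in> J" "\<bar>s $ i - t $ i\<bar> \<ge> 4 * \<epsilon>" by blast
        then show ?thesis using assms(2) by (intro bexI[of _ i]) linarith+
      qed
      show "\<exists>z\<in>facebox \<epsilon> J t. z \<in> zero_set f" if "t \<in> T" for t
        using T(2) that by (auto simp: hit_def)
      show "z \<notin> zero_set f" if "t \<in> T" "z \<in> facebox \<epsilon> J t" "i \<in> J" "\<bar>z $ i - t $ i\<bar> = \<epsilon>" for t z i
        using T(2) that by (auto simp: bd_hit_def)
    qed
  qed (use assms in auto)
  also have "emeasure lborel U = ennreal (measure lborel U)"
    unfolding U_def by (rule emeasure_eq_ennreal_measure) (simp add: emeasure_lborel_cbox_eq)
  also have "measure lborel U = (\<Prod>l\<in>UNIV. if l \<in> J then 4 * \<epsilon> else 2 * \<rho>)"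
    unfolding U_def
  proof (subst content_cbox_cart)
    show "cbox (\<chi> l. if l \<in> J then 0 else p $ l - \<rho>) (\<chi> l. if l \<in> J then 4 * \<epsilon> else p $ l + \<rho>) \<noteq> {}"
      using assms by (auto simp: interval_ne_empty_cart)
  qed (auto intro!: prod.cong)
  also have "\<dots> = (4 * \<epsilon>) ^ card J * (2 * \<rho>) ^ (CARD('n) - card J)"
    by (simp add: prod.If_cases Compl_eq_Diff_UNIV card_Diff_subset)
  finally show ?thesis
    using assms by (simp add: ennreal_of_nat_eq_real_of_nat ennreal_mult' del: of_nat_power of_nat_Suc)
qed

section \<open>Decomposing the cube into its faces\<close>

text \<open>Offset from the centre of the cube to the centre of a face with free directions
  \<open>J\<close>; \<open>S\<close> lists the fixed directions on the upper side. Requiring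
  \<open>S \<subseteq> - J\<close> later gives each face one label.\<close>

definition corner :: "real \<Rightarrow> 'n set \<Rightarrow> 'n set \<Rightarrow> real ^ 'n" where
  "corner \<epsilon> J S = (\<chi> i. if i \<in> J then 0 else if i \<in> S then \<epsilon> else - \<epsilon>)"

text \<open>Take a face of least positive dimension of the cube around \<open>x\<close> that meets \<open>V\<close>: either it is an
  edge, or its relative boundary misses \<open>V\<close>.\<close>

lemma hit_cube_subset:
  fixes V :: "(real ^ 'n::finite) set"
  assumes "\<epsilon> > 0"
  shows "hit \<epsilon> UNIV V \<subseteq>
    (\<Union>(i, S)\<in>(SIGMA i:UNIV. Pow (- {i})). {x. corner \<epsilon> {i} S + x \<in> hit \<epsilon> {i} V}) \<union>
    (\<Union>(J, S)\<in>(SIGMA J:{J. 2 \<le> card J}. Pow (- J)). {x. corner \<epsilon> J S + x \<in> hit \<epsilon> J V - bd_hit \<epsilon> J V})"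
proof
  fix x assume x: "x \<in> hit \<epsilon> UNIV V"
  define Q where "Q = (\<lambda>k. \<exists>J S. card J = k \<and> J \<noteq> {} \<and> S \<subseteq> - J \<and> corner \<epsilon> J S + x \<in> hit \<epsilon> J V)"
  have "corner \<epsilon> UNIV {} = (0 :: real ^ 'n)" by (simp add: corner_def vec_eq_iff)
  then have "Q CARD('n)" using x unfolding Q_def by - (rule exI[of _ UNIV], rule exI[of _ "{}"], simp)
  define k where "k = (LEAST k. Q k)"
  have "Q k" unfolding k_def using \<open>Q CARD('n)\<close> by (rule LeastI)
  then obtain J S where J: "card J = k" "J \<noteq> {}" "S \<subseteq> - J" "corner \<epsilon> J S + x \<in> hit \<epsilon> J V"
    unfolding Q_def by blast
  have "k > 0" using J by (metis card_gt_0_iff finite)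
  show "x \<in> (\<Union>(i, S)\<in>(SIGMA i:UNIV. Pow (- {i})). {x. corner \<epsilon> {i} S + x \<in> hit \<epsilon> {i} V}) \<union>
    (\<Union>(J, S)\<in>(SIGMA J:{J. 2 \<le> card J}. Pow (- J)). {x. corner \<epsilon> J S + x \<in> hit \<epsilon> J V - bd_hit \<epsilon> J V})"
  proof (cases "k = 1")
    case True
    then obtain i where "J = {i}" using J by (metis card_1_singletonE)
    then show ?thesis using J by blast
  next
    case False
    with \<open>k > 0\<close> have "2 \<le> card J" using J by simp
    moreover have "corner \<epsilon> J S + x \<notin> bd_hit \<epsilon> J V"
    proof
      assume "corner \<epsilon> J S + x \<in> bd_hit \<epsilon> J V"
      then obtain z i where z: "z \<in> V" "z \<in> facebox \<epsilon> J (corner \<epsilon> J S + x)" "i \<in> J"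
        "\<bar>z $ i - (corner \<epsilon> J S + x) $ i\<bar> = \<epsilon>" by (auto simp: bd_hit_def)
      \<comment> \<open>The zero lies on a side in direction \<open>i\<close>; fixing that
        coordinate there, up or down according to the sign, gives a face of one dimension
        less.\<close>
      define S' where "S' = (if z $ i > x $ i then insert i S else S)"
      have "z \<in> facebox \<epsilon> (J - {i}) (corner \<epsilon> (J - {i}) S' + x)"
        unfolding mem_facebox[OF assms]
      proof
        fix l
        have "if l \<in> J then \<bar>z $ l - (corner \<epsilon> J S + x) $ l\<bar> \<le> \<epsilon> else z $ l = (corner \<epsilon> J S + x) $ l"
          using z(2) unfolding mem_facebox[OF assms] by blast
        then show "if l \<in> J - {i} then \<bar>z $ l - (corner \<epsilon> (J - {i}) S' + x) $ l\<bar> \<le> \<epsilon>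
          else z $ l = (corner \<epsilon> (J - {i}) S' + x) $ l"
          using z(3,4) J(3) assms by (cases "l = i") (auto simp: corner_def S'_def)
      qed
      moreover have "S' \<subseteq> - (J - {i})" using J(3) by (auto simp: S'_def)
      moreover have "card (J - {i}) = k - 1" using J(1) z(3) by simp
      moreover have "card (J - {i}) > 0" using \<open>2 \<le> card J\<close> z(3) by simp
      then have "J - {i} \<noteq> {}" by (metis card.empty less_irrefl)
      ultimately have "Q (k - 1)" unfolding Q_def hit_def using z(1)
        by - (rule exI[of _ "J - {i}"], rule exI[of _ S'], auto)
      then have "k \<le> k - 1" unfolding k_def by (rule Least_le)
      then show False using \<open>k > 0\<close> by simp
    qed
    ultimately show ?thesis using J by blast
  qed
qed

section \<open>Probability of the tube\<close>

lemma emeasure_lborel_translate_preimage: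
  fixes E :: "'a::euclidean_space set"
  assumes "E \<in> sets borel"
  shows "emeasure lborel {x. c + x \<in> E} = emeasure lborel E"
proof -
  have "emeasure lborel E = emeasure (distr lborel borel ((+) c)) E"
    by (simp add: lborel_distr_plus)
  also have "\<dots> = emeasure lborel ((+) c -` E)"
    using assms by (subst emeasure_distr) auto
  finally show ?thesis by (simp add: vimage_def)
qed

text \<open>A union bound over the faces. By translation invariance the position of a face is
  immaterial and only its directions \<open>J\<close> count.\<close>

lemma measure_hit_cube_le:
  fixes p :: "real ^ 'n::finite"
  assumes "q > 0" "\<epsilon> > 0" "\<rho> > 0" "exp_rational q D f" "compact (zero_set f)" "zero_set f \<subseteq> cball p \<rho>"
  shows "measure lborel (hit \<epsilon> UNIV (zero_set f)) \<le>
    real CARD('n) * 2 ^ (CARD('n) - 1) *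
      (real D * (5 / 6 * (5 / 4) ^ (CARD('n) - 1) * (4 * \<epsilon> / \<rho>) * measure lborel (cball p \<rho>))) +
    (\<Sum>(J, S)\<in>(SIGMA J:{J :: 'n set. 2 \<le> card J}. Pow (- J)).
      real (Suc (2 * (card J * D)) ^ card J) * ((4 * \<epsilon>) ^ card J * (2 * \<rho>) ^ (CARD('n) - card J)))"
    (is "_ \<le> ?edges + ?faces")
proof -
  let ?V = "zero_set f"
  let ?I1 = "SIGMA i:(UNIV :: 'n set). Pow (- {i})"
  let ?I2 = "SIGMA J:{J :: 'n set. 2 \<le> card J}. Pow (- J)"
  let ?A1 = "\<lambda>(i, S). {x. corner \<epsilon> {i} S + x \<in> hit \<epsilon> {i} ?V}"
  let ?A2 = "\<lambda>(J, S). {x. corner \<epsilon> J S + x \<in> hit \<epsilon> J ?V - bd_hit \<epsilon> J ?V}"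
  let ?b = "real D * (5 / 6 * (5 / 4) ^ (CARD('n) - 1) * (4 * \<epsilon> / \<rho>) * measure lborel (cball p \<rho>))"
  let ?N = "\<lambda>J :: 'n set. real (Suc (2 * (card J * D)) ^ card J) * ((4 * \<epsilon>) ^ card J * (2 * \<rho>) ^ (CARD('n) - card J))"
  have meas: "hit \<epsilon> J ?V \<in> sets borel" "hit \<epsilon> J ?V - bd_hit \<epsilon> J ?V \<in> sets borel" for J
    by (intro sets.Diff borel_compact compact_hit compact_bd_hit assms(5))+
  have tr: "{x. c + x \<in> E} \<in> sets borel" if "E \<in> sets borel" for c and E :: "(real ^ 'n) set"
    using measurable_sets[of "(+) c" borel borel E] that by (simp add: vimage_def)
  have e1: "emeasure lborel (?A1 iS) \<le> ennreal ?b" for iS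
  proof (cases iS)
    case (Pair i S)
    have "emeasure lborel (?A1 iS) = emeasure lborel (hit \<epsilon> {i} ?V)"
      unfolding Pair prod.case by (rule emeasure_lborel_translate_preimage[OF meas(1)])
    also have "\<dots> \<le> of_nat D * emeasure lborel (thin_cylinder i p \<rho> (4 * \<epsilon>))"
      by (rule emeasure_hit_edge_le[OF assms])
    also have "emeasure lborel (thin_cylinder i p \<rho> (4 * \<epsilon>)) = ennreal (measure lborel (thin_cylinder i p \<rho> (4 * \<epsilon>)))"
      using assms emeasure_compact_finite[OF compact_thin_cylinder[of \<rho> "4 * \<epsilon>" i p]]
      by (intro emeasure_eq_ennreal_measure) auto
    also have "of_nat D * \<dots> = ennreal (real D * measure lborel (thin_cylinder i p \<rho> (4 * \<epsilon>)))"
      by (simp add: ennreal_of_nat_eq_real_of_nat ennreal_mult')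
    also have "\<dots> \<le> ennreal ?b"
      using assms by (intro ennreal_leI mult_left_mono measure_thin_cylinder_le) auto
    finally show ?thesis .
  qed
  have e2: "emeasure lborel (?A2 JS) \<le> ennreal (case JS of (J, S) \<Rightarrow> ?N J)" for JS
  proof (cases JS)
    case (Pair J S)
    have "emeasure lborel (?A2 JS) = emeasure lborel (hit \<epsilon> J ?V - bd_hit \<epsilon> J ?V)"
      unfolding Pair prod.case by (rule emeasure_lborel_translate_preimage[OF meas(2)])
    also have "\<dots> \<le> ennreal (?N J)" by (rule emeasure_hit_face_le[OF assms])
    finally show ?thesis by (simp add: Pair)
  qed
  have sets: "?A1 iS \<in> sets lborel" "?A2 JS \<in> sets lborel" for iS JS
    using tr[OF meas(1)] tr[OF meas(2)] by (auto split: prod.split)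
  have fin: "finite ?I1" "finite ?I2" by auto
  \<comment> \<open>The cube has \<open>2 ^ (CARD('n) - 1)\<close> edges in each of the
    \<open>CARD('n)\<close> directions.\<close>
  have "card ?I1 = (\<Sum>i\<in>(UNIV :: 'n set). card (Pow (- {i})))"
    by (rule card_SigmaI) auto
  also have "\<dots> = CARD('n) * 2 ^ (CARD('n) - 1)"
    by (simp add: card_Pow Compl_eq_Diff_UNIV card_Diff_subset)
  finally have card1: "real (card ?I1) = real CARD('n) * 2 ^ (CARD('n) - 1)" by simp
  have nonneg: "?b \<ge> 0" "?N J \<ge> 0" for J using assms by auto
  have "?edges \<ge> 0" by (rule mult_nonneg_nonneg[OF _ nonneg(1)]) simp
  moreover have "?faces \<ge> 0" using nonneg(2) by (intro sum_nonneg) (auto split: prod.split)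
  ultimately have nonneg': "?edges \<ge> 0" "?faces \<ge> 0" .
  have "emeasure lborel (hit \<epsilon> UNIV ?V) \<le> emeasure lborel ((\<Union>iS\<in>?I1. ?A1 iS) \<union> (\<Union>JS\<in>?I2. ?A2 JS))"
    using hit_cube_subset[OF assms(2), of ?V] sets fin
    by (intro emeasure_mono sets.Un sets.finite_UN) auto
  also have "\<dots> \<le> emeasure lborel (\<Union>iS\<in>?I1. ?A1 iS) + emeasure lborel (\<Union>JS\<in>?I2. ?A2 JS)"
    using sets fin by (intro emeasure_subadditive sets.finite_UN) auto
  also have "\<dots> \<le> (\<Sum>iS\<in>?I1. emeasure lborel (?A1 iS)) + (\<Sum>JS\<in>?I2. emeasure lborel (?A2 JS))"
    using sets fin by (intro add_mono emeasure_subadditive_finite) auto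
  also have "\<dots> \<le> (\<Sum>iS\<in>?I1. ennreal ?b) + (\<Sum>JS\<in>?I2. ennreal (case JS of (J, S) \<Rightarrow> ?N J))"
    by (intro add_mono sum_mono e1 e2)
  also have "\<dots> = ennreal (\<Sum>iS\<in>?I1. ?b) + ennreal (\<Sum>JS\<in>?I2. case JS of (J, S) \<Rightarrow> ?N J)"
    using nonneg by (intro arg_cong2[where f = "(+)"] sum_ennreal) (auto split: prod.split)
  also have "(\<Sum>iS\<in>?I1. ?b) = ?edges" by (simp only: sum_constant card1)
  also have "ennreal ?edges + ennreal (\<Sum>JS\<in>?I2. case JS of (J, S) \<Rightarrow> ?N J) = ennreal (?edges + ?faces)"
    by (rule ennreal_plus[OF nonneg', symmetric])
  finally have "emeasure lborel (hit \<epsilon> UNIV ?V) \<le> ennreal (?edges + ?faces)" .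
  moreover have "0 \<le> ?edges + ?faces" by (rule add_nonneg_nonneg[OF nonneg'])
  ultimately show ?thesis unfolding measure_def by (intro enn2real_leI)
qed

text \<open>Compactness provides a nearest point of \<open>V\<close>, and the Euclidean ball of
  radius \<open>\<epsilon>\<close> lies in the cube of half-width \<open>\<epsilon>\<close>.\<close>

lemma prob_set_distance_le:
  fixes p :: "real ^ 'n::finite"
  assumes "\<epsilon> > 0" "\<rho> > 0" "compact V"
  shows "\<P>(x in uniform_measure lborel (cball p \<rho>). set_distance x V \<le> ereal \<epsilon>)
    \<le> measure lborel (hit \<epsilon> UNIV V) / measure lborel (cball p \<rho>)"
proof -
  define A where "A = {x :: real ^ 'n. set_distance x V \<le> ereal \<epsilon>}"
  have sub: "A \<subseteq> hit \<epsilon> UNIV V"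
  proof
    fix x assume x: "x \<in> A"
    \<comment> \<open>The empty set is at infinite distance, so it cannot satisfy the bound
      \<open>\<epsilon>\<close>.\<close>
    then have "V \<noteq> {}" by (auto simp: A_def set_distance_def top_ereal_def)
    from distance_attains_inf[OF compact_imp_closed[OF assms(3)] this, of x]
    obtain y where y: "y \<in> V" "\<forall>z\<in>V. dist x y \<le> dist x z" by metis
    then have "ereal (dist x y) \<le> set_distance x V"
      unfolding set_distance_def by (intro INF_greatest) auto
    also have "set_distance x V \<le> ereal \<epsilon>" using x by (simp add: A_def)
    finally have "ereal (dist x y) \<le> ereal \<epsilon>" .
    then have "norm (y - x) \<le> \<epsilon>" by (simp add: dist_norm norm_minus_commute)
    moreover have "\<bar>y $ i - x $ i\<bar> \<le> norm (y - x)" for i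
      using component_le_norm_cart[of "y - x" i] by simp
    ultimately have "y \<in> facebox \<epsilon> UNIV x"
      unfolding mem_facebox[OF assms(1)] using order_trans by auto
    with y(1) show "x \<in> hit \<epsilon> UNIV V" by (auto simp: hit_def)
  qed
  have fin: "emeasure lborel (cball p \<rho>) \<noteq> \<infinity>"
    using emeasure_compact_finite[of "cball p \<rho>"] by auto
  have pos: "measure lborel (cball p \<rho>) > 0" using assms(2) by (rule content_cball_pos)
  then have ne0: "emeasure lborel (cball p \<rho>) \<noteq> 0" by (auto simp: measure_def)
  have "measure (uniform_measure lborel (cball p \<rho>)) A \<le> measure lborel (hit \<epsilon> UNIV V) / measure lborel (cball p \<rho>)"
  proof (cases "A \<in> sets lborel")
    case True
    have hitc: "compact (hit \<epsilon> UNIV V)" by (rule compact_hit[OF assms(3)])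
    have "hit \<epsilon> UNIV V \<in> fmeasurable lborel"
      using emeasure_compact_finite[OF hitc] borel_compact[OF hitc]
      by (intro fmeasurableI) auto
    then have "measure lborel (cball p \<rho> \<inter> A) \<le> measure lborel (hit \<epsilon> UNIV V)"
      using True sub by (intro measure_mono_fmeasurable) auto
    then show ?thesis
      using pos by (subst measure_uniform_measure[OF ne0 fin True]) (intro divide_right_mono, auto)
  next
    \<comment> \<open>\<open>measure\<close> is 0 by default outside the sigma-algebra, so
      measurability of \<open>A\<close> can stay open.\<close>
    case False
    then show ?thesis by (subst measure_notin_sets) auto
  qed
  then show ?thesis by (simp add: A_def)
qed

text \<open>The maximum is attained since \<open>w \<ge> 1\<close>, so \<open>L\<close> is the
  absolute value of some integer \<open>q * a k $ i\<close> and can serve as a degree.\<close>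

lemma exp_rational_of_rational_sigmoid_network:
  fixes f :: "real ^ 'n::finite \<Rightarrow> real"
  assumes "rational_sigmoid_network w L f" "w \<ge> 1"
  obtains q Ln where "q > 0" "L = real Ln" "exp_rational q (Ln * w) f"
proof -
  obtain c0 d a b and q :: nat where f: "\<And>x. f x = c0 + (\<Sum>k = 1..w. d k * logistic (a k \<bullet> x + b k))"
    and q: "q > 0" "\<And>k i. k \<in> {1..w} \<Longrightarrow> real q * a k $ i \<in> \<int>"
    and L: "L = real q * Max {\<bar>a k $ i\<bar> | k i. k \<in> {1..w}}"
    using assms(1) unfolding rational_sigmoid_network_def by blast
  let ?S = "{\<bar>a k $ i\<bar> | k i. k \<in> {1..w}}"
  have S: "?S = (\<lambda>(k, i). \<bar>a k $ i\<bar>) ` ({1..w} \<times> UNIV)" by auto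
  have "finite ?S" unfolding S by (intro finite_imageI) auto
  moreover have "?S \<noteq> {}" using assms(2) by auto
  ultimately have "Max ?S \<in> ?S" by (rule Max_in)
  then obtain k i where ki: "k \<in> {1..w}" "Max ?S = \<bar>a k $ i\<bar>" by auto
  then have L': "L = \<bar>real q * a k $ i\<bar>" unfolding L by (simp add: abs_mult)
  obtain z where z: "real q * a k $ i = of_int z" using q(2)[OF ki(1), of i] by (auto elim: Ints_cases)
  have Ln: "L = real (nat \<bar>z\<bar>)" unfolding L' z by simp
  have "\<bar>real q * a k $ i\<bar> \<le> real (nat \<bar>z\<bar>)" if "k \<in> {1..w}" for k i
  proof -
    have "\<bar>a k $ i\<bar> \<le> Max ?S" using \<open>finite ?S\<close> that by (intro Max_ge) auto
    then have "real q * \<bar>a k $ i\<bar> \<le> L" unfolding L by (intro mult_left_mono) auto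
    then show ?thesis using Ln by (simp add: abs_mult)
  qed
  then have "exp_rational (real q) (nat \<bar>z\<bar> * w) (\<lambda>x. c0 + (\<Sum>k = 1..w. d k * logistic (a k \<bullet> x + b k)))"
    using q by (intro exp_rational_network) auto
  moreover have "f = (\<lambda>x. c0 + (\<Sum>k = 1..w. d k * logistic (a k \<bullet> x + b k)))" using f by auto
  ultimately show thesis using that[of "real q" "nat \<bar>z\<bar>"] q(1) Ln by simp
qed

section \<open>The constants of first and second order\<close>

text \<open>The left side is the edge contribution divided by
  \<open>2 * n * \<epsilon> / \<rho>\<close> and by the volume of the ball. For
  \<open>D \<ge> 1\<close>, both \<open>5 / 2\<close> and \<open>5 / 3 * D\<close> are at most
  \<open>2 * D + 1\<close>.\<close>

lemma edge_constant_le: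
  fixes D n :: nat
  assumes "n > 0"
  shows "5 / 3 * (5 / 2) ^ (n - 1) * real D \<le> (2 * real D + 1) ^ n"
proof (cases "D = 0")
  case False
  then have "real D \<ge> 1" by simp
  then have "(5 / 2) ^ (n - 1) * (5 / 3 * real D) \<le> (2 * real D + 1) ^ (n - 1) * (2 * real D + 1)"
    by (intro mult_mono power_mono) auto
  also have "\<dots> = (2 * real D + 1) ^ n" using assms by (cases n) auto
  finally show ?thesis by (simp add: mult_ac)
qed simp

text \<open>Up to constants and a factor \<open>\<rho> ^ CARD('n)\<close>, a face of dimension
  \<open>j\<close> contributes \<open>(w * \<epsilon> / \<rho>) ^ j\<close>. Since
  \<open>j \<ge> 2\<close> and \<open>small\<close> bounds the base by 1, each such power is of
  second order.\<close>

lemma face_sum_le: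
  fixes \<rho> \<epsilon> :: real and w L :: nat
  assumes "\<rho> > 0" "\<epsilon> > 0" "w \<ge> 1" and small: "real w ^ CARD('n::finite) * (\<epsilon> / \<rho>) \<le> 1"
  shows "(\<Sum>(J, S)\<in>(SIGMA J:{J :: 'n set. 2 \<le> card J}. Pow (- J)).
      real (Suc (2 * (card J * (L * w))) ^ card J) * ((4 * \<epsilon>) ^ card J * (2 * \<rho>) ^ (CARD('n) - card J)))
    \<le> 16 ^ CARD('n) * (2 * real CARD('n) * real L + 1) ^ CARD('n) * \<rho> ^ CARD('n) *
      (real w ^ (2 * CARD('n)) * (\<epsilon> / \<rho>)\<^sup>2)" (is "?lhs \<le> _")
proof -
  define n where "n = CARD('n)"
  define r where "r = \<epsilon> / \<rho>"
  let ?I = "SIGMA J:{J :: 'n set. 2 \<le> card J}. Pow (- J)"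
  define K where "K = 4 ^ n * (2 * real n * real L + 1) ^ n * \<rho> ^ n * (real w ^ (2 * n) * r\<^sup>2)"
  have r: "r > 0" using assms by (simp add: r_def)
  have eps: "\<epsilon> = r * \<rho>" using assms by (simp add: r_def)
  have "n > 0" by (simp add: n_def)
  have term_le: "real (Suc (2 * (card J * (L * w))) ^ card J) * ((4 * \<epsilon>) ^ card J * (2 * \<rho>) ^ (n - card J)) \<le> K"
    if J: "2 \<le> card J" for J :: "'n set"
  proof -
    let ?j = "card J"
    have jn: "?j \<le> n" unfolding n_def by (rule card_mono) auto
    have "real (Suc (2 * (?j * (L * w)))) = 2 * real ?j * real L * real w + 1" by simp
    also have "\<dots> \<le> 2 * real n * real L * real w + real w"
      using jn assms by (intro add_mono mult_right_mono) auto
    also have "\<dots> = (2 * real n * real L + 1) * real w" by (simp add: algebra_simps)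
    finally have "real (Suc (2 * (?j * (L * w)))) ^ ?j \<le> ((2 * real n * real L + 1) * real w) ^ ?j"
      by (intro power_mono) auto
    also have "\<dots> = (2 * real n * real L + 1) ^ ?j * real w ^ ?j" by (rule power_mult_distrib)
    also have "\<dots> \<le> (2 * real n * real L + 1) ^ n * real w ^ ?j"
      using jn by (intro mult_right_mono power_increasing) auto
    finally have N: "real (Suc (2 * (?j * (L * w))) ^ ?j) \<le> (2 * real n * real L + 1) ^ n * real w ^ ?j"
      by simp
    have "(4 * \<epsilon>) ^ ?j * (2 * \<rho>) ^ (n - ?j) = 4 ^ ?j * 2 ^ (n - ?j) * r ^ ?j * (\<rho> ^ ?j * \<rho> ^ (n - ?j))"
      by (simp add: eps power_mult_distrib mult_ac)
    also have "\<rho> ^ ?j * \<rho> ^ (n - ?j) = \<rho> ^ n" using jn by (simp add: power_add[symmetric])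
    also have "4 ^ ?j * 2 ^ (n - ?j) * r ^ ?j * \<rho> ^ n \<le> 4 ^ ?j * 4 ^ (n - ?j) * r ^ ?j * \<rho> ^ n"
      using r assms by (intro mult_right_mono mult_left_mono power_mono) auto
    also have "(4::real) ^ ?j * 4 ^ (n - ?j) = 4 ^ n" using jn by (simp add: power_add[symmetric])
    finally have V: "(4 * \<epsilon>) ^ ?j * (2 * \<rho>) ^ (n - ?j) \<le> 4 ^ n * r ^ ?j * \<rho> ^ n" .
    have "real w \<le> real w ^ n" using assms \<open>n > 0\<close> by (intro self_le_power) auto
    then have wr: "real w * r \<le> real w ^ n * r" using r by (intro mult_right_mono) auto
    have "(real w * r) ^ ?j \<le> (real w ^ n * r) ^ ?j" using wr r by (intro power_mono) auto
    also have "\<dots> \<le> (real w ^ n * r)\<^sup>2"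
      using J r small[folded n_def r_def] by (intro power_decreasing mult_nonneg_nonneg) simp_all
    also have "\<dots> = real w ^ (2 * n) * r\<^sup>2"
      by (simp add: power_mult_distrib power_mult[symmetric] mult.commute)
    finally have W: "(real w * r) ^ ?j \<le> real w ^ (2 * n) * r\<^sup>2" .
    have "real (Suc (2 * (?j * (L * w))) ^ ?j) * ((4 * \<epsilon>) ^ ?j * (2 * \<rho>) ^ (n - ?j))
      \<le> ((2 * real n * real L + 1) ^ n * real w ^ ?j) * (4 ^ n * r ^ ?j * \<rho> ^ n)"
      using assms by (intro mult_mono N V) auto
    also have "\<dots> = 4 ^ n * (2 * real n * real L + 1) ^ n * \<rho> ^ n * (real w * r) ^ ?j"
      by (simp add: power_mult_distrib mult_ac)
    also have "\<dots> \<le> K" unfolding K_def using assms by (intro mult_left_mono W) auto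
    finally show ?thesis .
  qed
  have "?lhs \<le> (\<Sum>JS\<in>?I. K)" using term_le by (intro sum_mono) (auto simp: n_def)
  also have "\<dots> = real (card ?I) * K" by simp
  also have "\<dots> \<le> 4 ^ n * K"
  proof (rule mult_right_mono)
    \<comment> \<open>Bounding the labels by all pairs of subsets accounts for one of the two
      factors \<open>4 ^ n\<close> in \<open>16 ^ n\<close>.\<close>
    have "card ?I \<le> card ((UNIV :: 'n set set) \<times> (UNIV :: 'n set set))" by (rule card_mono) auto
    also have "\<dots> = 2 ^ n * 2 ^ n" by (simp add: card_cartesian_product card_UNIV_set n_def)
    also have "\<dots> = 4 ^ n" by (simp add: power_mult_distrib[symmetric])
    finally have "real (card ?I) \<le> real (4 ^ n)" by (rule of_nat_mono)
    then show "real (card ?I) \<le> 4 ^ n" by simp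
    show "K \<ge> 0" using assms by (auto simp: K_def)
  qed
  also have "\<dots> = 16 ^ n * (2 * real n * real L + 1) ^ n * \<rho> ^ n * (real w ^ (2 * n) * r\<^sup>2)"
  proof -
    have "(16 :: real) ^ n = 4 ^ n * 4 ^ n" by (simp add: power_mult_distrib[symmetric])
    then show ?thesis by (simp add: K_def mult_ac)
  qed
  finally show ?thesis by (simp add: n_def r_def)
qed

text \<open>The constant is that of \<open>face_sum_le\<close> divided by the volume of the unit
  ball. The extra 1 makes it at least 1, so the bound is trivial once
  \<open>w ^ CARD('n) * \<epsilon> / \<rho>\<close> exceeds 1.\<close>

lemma prob_zero_set_tube_le:
  fixes f :: "real ^ 'n::finite \<Rightarrow> real"
  assumes "w \<ge> 1" "rational_sigmoid_network w L f" "\<rho> > 0" "zero_set f \<subseteq> cball p \<rho>" "\<epsilon> > 0"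
  shows "\<P>(x in uniform_measure lborel (cball p \<rho>). set_distance x (zero_set f) \<le> ereal \<epsilon>)
    \<le> 2 * real CARD('n) * (2 * L * real w + 1) ^ CARD('n) * (\<epsilon> / \<rho>) +
      (16 ^ CARD('n) * (2 * real CARD('n) * \<bar>L\<bar> + 1) ^ CARD('n) / unit_ball_vol (real CARD('n)) + 1) *
      (real w ^ (2 * CARD('n)) * (\<epsilon> / \<rho>)\<^sup>2)" (is "?P \<le> ?first + ?C * ?second")
proof -
  define n where "n = CARD('n)"
  define r where "r = \<epsilon> / \<rho>"
  have "n > 0" by (simp add: n_def)
  have r: "r > 0" using assms by (simp add: r_def)
  obtain q Ln where q: "q > 0" "L = real Ln" "exp_rational q (Ln * w) f"
    using exp_rational_of_rational_sigmoid_network[OF assms(2,1)] .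
  define \<beta> where "\<beta> = measure lborel (cball p \<rho>)"
  have \<beta>: "\<beta> = unit_ball_vol (real n) * \<rho> ^ n"
    using assms by (simp add: \<beta>_def n_def content_cball)
  have vol: "unit_ball_vol (real n) > 0" by simp
  have "\<beta> > 0" using \<beta> vol assms by simp
  have first0: "?first \<ge> 0"
    using r unfolding q(2) r_def by (intro mult_nonneg_nonneg zero_le_power) simp_all
  have C1: "?C \<ge> 1" using vol by (simp add: n_def)
  show ?thesis
  proof (cases "real w ^ n * r \<le> 1")
    case False
    \<comment> \<open>Here the second-order term alone is at least 1.\<close>
    interpret prob_space "uniform_measure lborel (cball p \<rho>)"
      using content_cball_pos[OF assms(3), of p] emeasure_compact_finite[of "cball p \<rho>"]
      by (intro prob_space_uniform_measure) (auto simp: measure_def)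
    have "1 \<le> (real w ^ n * r)\<^sup>2" using False by (intro one_le_power) auto
    also have "\<dots> = ?second"
      unfolding n_def r_def power_mult_distrib power_mult[symmetric] by (simp add: mult.commute)
    finally have "1 \<le> ?second" .
    then have "1 * 1 \<le> ?C * ?second" using C1 by (intro mult_mono) auto
    moreover have "?P \<le> 1" by (rule prob_le_1)
    ultimately show ?thesis using first0 by linarith
  next
    case True
    have "closed (zero_set f)"
      unfolding zero_set_def
      by (intro closed_Collect_eq exp_rational_continuous[OF q(3)] continuous_on_const)
    then have compact: "compact (zero_set f)"
      using assms(4) bounded_subset[OF bounded_cball] by (auto simp: compact_eq_bounded_closed)
    let ?edges = "real n * 2 ^ (n - 1) * (real (Ln * w) * (5 / 6 * (5 / 4) ^ (n - 1) * (4 * \<epsilon> / \<rho>) * \<beta>))"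
    have "(5 / 2 :: real) ^ (n - 1) = 2 ^ (n - 1) * (5 / 4) ^ (n - 1)"
      by (simp add: power_mult_distrib[symmetric])
    then have "?edges = 2 * real n * (5 / 3 * (5 / 2) ^ (n - 1) * real (Ln * w)) * r * \<beta>"
      by (simp add: r_def)
    also have "\<dots> \<le> 2 * real n * (2 * real (Ln * w) + 1) ^ n * r * \<beta>"
      using r \<open>\<beta> > 0\<close> by (intro mult_right_mono mult_left_mono edge_constant_le[OF \<open>n > 0\<close>]) simp_all
    finally have edges: "?edges \<le> ?first * \<beta>" by (simp add: q(2) n_def r_def mult_ac)
    have "16 ^ n * (2 * real n * real Ln + 1) ^ n * \<rho> ^ n * ?second =
      (16 ^ n * (2 * real n * real Ln + 1) ^ n / unit_ball_vol (real n)) * ?second * \<beta>"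
      by (simp add: \<beta> less_imp_neq[OF vol, symmetric])
    also have "\<dots> \<le> ?C * ?second * \<beta>"
      using \<open>\<beta> > 0\<close> by (intro mult_right_mono) (auto simp: q(2) n_def)
    finally have faces: "16 ^ n * (2 * real n * real Ln + 1) ^ n * \<rho> ^ n * ?second \<le> ?C * ?second * \<beta>" .
    have "measure lborel (hit \<epsilon> UNIV (zero_set f)) \<le> ?first * \<beta> + ?C * ?second * \<beta>"
      using measure_hit_cube_le[OF q(1) assms(5,3) q(3) compact assms(4)]
        face_sum_le[OF assms(3,5,1) True[unfolded n_def r_def], where L = Ln] edges faces
      unfolding n_def r_def \<beta>_def by linarith
    then have "measure lborel (hit \<epsilon> UNIV (zero_set f)) / \<beta> \<le> ?first + ?C * ?second"
      using \<open>\<beta> > 0\<close> by (simp add: divide_le_eq algebra_simps)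
    with prob_set_distance_le[OF assms(5,3) compact, of p] show ?thesis
      unfolding \<beta>_def by linarith
  qed
qed

text \<open>With \<open>r = \<epsilon> / \<rho>\<close>, the quadratic term is
  \<open>C * (w ^ n * r)\<^sup>2\<close>, and one factor \<open>w ^ n * r\<close> is at most
  \<open>A\<close>. In the first term, \<open>w \<ge> 1\<close> lets a power of \<open>w\<close> be
  factored out; \<open>\<bar>L\<bar>\<close> covers every real \<open>L\<close>.\<close>

lemma first_order_regime:
  fixes L A C \<rho> \<epsilon> :: real
  assumes "w \<ge> 1" "\<rho> > 0" "\<epsilon> > 0" "C > 0" "\<epsilon> / \<rho> \<le> A / real w ^ n"
  shows "2 * real n * (2 * L * real w + 1) ^ n * (\<epsilon> / \<rho>) + C * (real w ^ (2 * n) * (\<epsilon> / \<rho>)\<^sup>2)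
    \<le> (2 * real n * (2 * \<bar>L\<bar> + 1) ^ n + C * A) * real w ^ n * (\<epsilon> / \<rho>)"
proof -
  define r where "r = \<epsilon> / \<rho>"
  have r: "r > 0" using assms by (simp add: r_def)
  have "\<bar>2 * L * real w + 1\<bar> \<le> \<bar>2 * L * real w\<bar> + 1"
    by (rule order_trans[OF abs_triangle_ineq]) simp
  also have "\<dots> \<le> 2 * \<bar>L\<bar> * real w + real w" using assms by (simp add: abs_mult)
  also have "\<dots> = (2 * \<bar>L\<bar> + 1) * real w" by (simp add: algebra_simps)
  finally have "\<bar>2 * L * real w + 1\<bar> ^ n \<le> ((2 * \<bar>L\<bar> + 1) * real w) ^ n"
    by (intro power_mono) auto
  moreover have "(2 * L * real w + 1) ^ n \<le> \<bar>2 * L * real w + 1\<bar> ^ n"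
    by (metis abs_ge_self power_abs)
  ultimately have "(2 * L * real w + 1) ^ n \<le> (2 * \<bar>L\<bar> + 1) ^ n * real w ^ n"
    by (simp add: power_mult_distrib)
  then have first: "2 * real n * (2 * L * real w + 1) ^ n * r \<le> 2 * real n * ((2 * \<bar>L\<bar> + 1) ^ n * real w ^ n) * r"
    using r by (intro mult_right_mono mult_left_mono) auto
  have "real w ^ n * r \<le> A"
    using assms by (simp add: r_def pos_le_divide_eq mult.commute)
  then have "(real w ^ n * r) * (real w ^ n * r) \<le> A * (real w ^ n * r)"
    using r by (intro mult_right_mono) auto
  moreover have "real w ^ (2 * n) * r\<^sup>2 = (real w ^ n * r) * (real w ^ n * r)"
    by (simp add: power2_eq_square mult_2 power_add)
  ultimately have "C * (real w ^ (2 * n) * r\<^sup>2) \<le> C * (A * (real w ^ n * r))"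
    using assms by (intro mult_left_mono) simp_all
  with first show ?thesis unfolding r_def[symmetric] by (simp add: algebra_simps)
qed

theorem corollary4p18:
  fixes L :: real
  shows "\<exists>C :: real. C > 0 \<and>
    (\<forall>(w :: nat) (f :: real ^ 'n \<Rightarrow> real) (p :: real ^ 'n) (\<rho> :: real) (\<epsilon> :: real).
       w \<ge> 1 \<longrightarrow> rational_sigmoid_network w L f \<longrightarrow> \<not> f constant_on UNIV \<longrightarrow>
       (\<forall>x \<in> zero_set f. gradient f x \<noteq> 0) \<longrightarrow>
       \<rho> > 0 \<longrightarrow> zero_set f \<subseteq> cball p \<rho> \<longrightarrow> \<epsilon> > 0 \<longrightarrow>
       \<P>(x in uniform_measure lborel (cball p \<rho>). set_distance x (zero_set f) \<le> ereal \<epsilon>)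
         \<le> 2 * real CARD('n) * (2 * L * real w + 1) ^ CARD('n) * (\<epsilon> / \<rho>)
            + C * (real w ^ (2 * CARD('n)) * (\<epsilon> / \<rho>)\<^sup>2)) \<and>
    (\<forall>A :: real. A > 0 \<longrightarrow> (\<exists>C' :: real.
       (\<forall>(w :: nat) (\<rho> :: real) (\<epsilon> :: real).
          w \<ge> 1 \<longrightarrow> \<rho> > 0 \<longrightarrow> \<epsilon> > 0 \<longrightarrow> \<epsilon> / \<rho> \<le> A / real w ^ CARD('n) \<longrightarrow>
          2 * real CARD('n) * (2 * L * real w + 1) ^ CARD('n) * (\<epsilon> / \<rho>)
            + C * (real w ^ (2 * CARD('n)) * (\<epsilon> / \<rho>)\<^sup>2)
          \<le> C' * real w ^ CARD('n) * (\<epsilon> / \<rho>)) \<and>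
       (\<forall>(w :: nat) (f :: real ^ 'n \<Rightarrow> real) (p :: real ^ 'n) (\<rho> :: real) (\<epsilon> :: real).
          w \<ge> 1 \<longrightarrow> rational_sigmoid_network w L f \<longrightarrow> \<not> f constant_on UNIV \<longrightarrow>
          (\<forall>x \<in> zero_set f. gradient f x \<noteq> 0) \<longrightarrow>
          \<rho> > 0 \<longrightarrow> zero_set f \<subseteq> cball p \<rho> \<longrightarrow> \<epsilon> > 0 \<longrightarrow>
          \<epsilon> / \<rho> \<le> A / real w ^ CARD('n) \<longrightarrow>
          \<P>(x in uniform_measure lborel (cball p \<rho>). set_distance x (zero_set f) \<le> ereal \<epsilon>)
            \<le> C' * real w ^ CARD('n) * (\<epsilon> / \<rho>))))"
proof -
  \<comment> \<open>Only \<open>L\<close> and the dimension enter, so the constant may be fixed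
    before \<open>w\<close>, \<open>f\<close>, \<open>p\<close>, \<open>\<rho>\<close> and
    \<open>\<epsilon>\<close>.\<close>
  define C where "C = 16 ^ CARD('n) * (2 * real CARD('n) * \<bar>L\<bar> + 1) ^ CARD('n) / unit_ball_vol (real CARD('n)) + 1"
  have "C > 0" unfolding C_def by (intro add_nonneg_pos divide_nonneg_nonneg) auto
  note tube = prob_zero_set_tube_le[where L = L and 'n = 'n, folded C_def]
  note regime = first_order_regime[OF _ _ _ \<open>C > 0\<close>, where L = L and n = "CARD('n)"]
  show ?thesis
  proof (rule exI[of _ C], intro conjI allI impI)
    show "C > 0" by fact
  next
    fix A :: real
    assume "A > 0"
    show "\<exists>C'. (\<forall>(w :: nat) (\<rho> :: real) (\<epsilon> :: real).
          w \<ge> 1 \<longrightarrow> \<rho> > 0 \<longrightarrow> \<epsilon> > 0 \<longrightarrow> \<epsilon> / \<rho> \<le> A / real w ^ CARD('n) \<longrightarrow>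
          2 * real CARD('n) * (2 * L * real w + 1) ^ CARD('n) * (\<epsilon> / \<rho>)
            + C * (real w ^ (2 * CARD('n)) * (\<epsilon> / \<rho>)\<^sup>2)
          \<le> C' * real w ^ CARD('n) * (\<epsilon> / \<rho>)) \<and>
       (\<forall>(w :: nat) (f :: real ^ 'n \<Rightarrow> real) (p :: real ^ 'n) (\<rho> :: real) (\<epsilon> :: real).
          w \<ge> 1 \<longrightarrow> rational_sigmoid_network w L f \<longrightarrow> \<not> f constant_on UNIV \<longrightarrow>
          (\<forall>x \<in> zero_set f. gradient f x \<noteq> 0) \<longrightarrow>
          \<rho> > 0 \<longrightarrow> zero_set f \<subseteq> cball p \<rho> \<longrightarrow> \<epsilon> > 0 \<longrightarrow>
          \<epsilon> / \<rho> \<le> A / real w ^ CARD('n) \<longrightarrow>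
          \<P>(x in uniform_measure lborel (cball p \<rho>). set_distance x (zero_set f) \<le> ereal \<epsilon>)
            \<le> C' * real w ^ CARD('n) * (\<epsilon> / \<rho>))"
    proof (rule exI[of _ "2 * real CARD('n) * (2 * \<bar>L\<bar> + 1) ^ CARD('n) + C * A"], intro conjI allI impI, goal_cases)
      case (1 w \<rho> \<epsilon>)
      then show ?case by (intro regime)
    next
      case (2 w f p \<rho> \<epsilon>)
      show ?case using tube[OF 2(1,2,5,6,7)] regime[OF 2(1,5,7,8)] by (rule order_trans)
    qed
  qed (rule tube; assumption)
qed

end
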